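(* Let $\Psi\in\mathcal B_0$ be strictly increasing and satisfy the weak lower scaling property with parameters $\underline\mu>0$, $\underline c\in(0,1]$, $\underline\theta\ge0$. Let $\mathcal D\subset\mathbb R^d$ be a bounded domain with regular boundary, $T>0$, $Q_T=[0,T)\times\mathcal D$, and let $V:[0,\infty)\times\mathbb R^d\to\mathbb R$ be bounded, measurable, with $V\ge0$. Let $p$ satisfy $p-1>\frac{d}{2\underline\mu}$, let $f\in L^p(Q_T)$, and let $\varphi$ be a bounded parabolic weak sub-solution of $-\partial_t\varphi+H^{\mathcal D,V}\varphi\le f$ in $Q_T$. Then there exists a constant $C=C(p,d,\Psi)$ (depending only on $p,d,\Psi$) such that $$\sup_{Q_T}\varphi^+\le\Big(\sup_{[0,T)\times\mathcal D^c}\varphi^+\ \vee\ \sup_{\{T\}\times\mathcal D}\varphi^+\Big)+C\left[1+\frac{1}{\big(\Psi([\operatorname{diam}\mathcal D]^{-2})\big)^{2/p'}}\right]\|f\|_{L^p(Q_T)},$$ where $\frac1p+\frac1{p'}=1$.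
   Context: $\mathcal B_0$ is the set of Bernstein functions $\Psi\in C^\infty((0,\infty))$ with $\Psi\ge0$, $(-1)^n\Psi^{(n)}\le0$ for all integers $n\ge1$, and $\lim_{u\downarrow0}\Psi(u)=0$. Weak lower scaling with parameters $\underline\mu>0,\underline c\in(0,1],\underline\theta\ge0$: $\Psi(\gamma u)\ge\underline c\,\gamma^{\underline\mu}\Psi(u)$ for all $u>\underline\theta$, $\gamma\ge1$. $(X_t)_{t\ge0}$ is the subordinate Brownian motion $X_t=B_{S_t}$ in $\mathbb R^d$, where $B$ is $d$-dimensional Brownian motion with $\mathbb E[e^{i\xi\cdot B_t}]=e^{-t|\xi|^2}$ and $S$ is an independent subordinator with $\mathbb E[e^{-uS_t}]=e^{-t\Psi(u)}$; $X$ is a Lévy process with generator $-\Psi(-\Delta)$. $\mathbb P^x,\mathbb E^x$ refer to $X$ started at $x$. $\tau_{\mathcal D}=\inf\{t>0: X_t\notin\mathcal D\}$. The boundary of $\mathcal D$ is regular if $\mathbb P^z(\tau_{\mathcal D}=0)=1$ for every $z\in\partial\mathcal D$. $H^{\mathcal D,V}=\Psi(-\Delta)+V$ on $\mathcal D$. A function $\varphi\in C([0,T]\times\mathbb R^d)$ is a parabolic weak sub-solution of $-\partial_t\varphi+H^{\mathcal D,V}\varphi\le f$ in $Q_T$ if for every $t\in[0,T)$ and $x\in\mathcal D$, $$\varphi(t,x)\le\mathbb E^x\big[e^{-\int_0^{(T-t)\wedge\tau_{\mathcal D}}V(t+s,X_s)ds}\,\varphi(t+(T-t)\wedge\tau_{\mathcal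 D},X_{(T-t)\wedge\tau_{\mathcal D}})\big]+\mathbb E^x\Big[\int_0^{(T-t)\wedge\tau_{\mathcal D}}e^{-\int_0^sV(t+r,X_r)dr}f(t+s,X_s)\,ds\Big].$$ $\varphi^+=\max(\varphi,0)$, $\mathcal D^c=\mathbb R^d\setminus\mathcal D$, $a\vee b=\max(a,b)$. *)

theory Defs
  imports "HOL-Probability.Probability"
begin

section \<open>Bernstein functions\<close>

text \<open>Only the values on the open half line matter; the iterated \<^const>\<open>deriv\<close> at a point
  \<open>u > 0\<close> depends only on values near \<open>u\<close>.\<close>

definition smooth_on_pos :: "(real \<Rightarrow> real) \<Rightarrow> bool" where
  "smooth_on_pos \<Psi> \<longleftrightarrow> (\<forall>n. \<forall>u>0. (deriv ^^ n) \<Psi> field_differentiable (at u))"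

definition bernstein0 :: "(real \<Rightarrow> real) \<Rightarrow> bool" where
  "bernstein0 \<Psi> \<longleftrightarrow>
     smooth_on_pos \<Psi> \<and>
     (\<forall>u>0. 0 \<le> \<Psi> u) \<and>
     (\<forall>n\<ge>1. \<forall>u>0. (-1) ^ n * (deriv ^^ n) \<Psi> u \<le> 0) \<and>
     (\<Psi> \<longlongrightarrow> 0) (at_right 0)"

definition weak_lower_scaling :: "(real \<Rightarrow> real) \<Rightarrow> real \<Rightarrow> real \<Rightarrow> real \<Rightarrow> bool" where
  "weak_lower_scaling \<Psi> \<mu> c \<theta> \<longleftrightarrow>
     (\<forall>u>\<theta>. \<forall>\<gamma>\<ge>1. \<Psi> (\<gamma> * u) \<ge> c * \<gamma> powr \<mu> * \<Psi> u)"


section \<open>Subordinate Brownian motion\<close>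

text \<open>Processes are indexed by \<^typ>\<open>real\<close>; only times \<open>t \<ge> 0\<close> are constrained.\<close>

definition cadlag :: "(real \<Rightarrow> 'a::topological_space) \<Rightarrow> bool" where
  "cadlag x \<longleftrightarrow>
     (\<forall>t\<ge>0. (x \<longlongrightarrow> x t) (at_right t)) \<and> (\<forall>t>0. \<exists>l. (x \<longlongrightarrow> l) (at_left t))"

definition levy_process :: "'w measure \<Rightarrow> (real \<Rightarrow> 'w \<Rightarrow> 'a::euclidean_space) \<Rightarrow> bool" where
  "levy_process M X \<longleftrightarrow>
     prob_space M \<and>
     (\<forall>t\<ge>0. X t \<in> borel_measurable M) \<and>
     (AE \<omega> in M. X 0 \<omega> = 0) \<and>
     (\<forall>(n::nat) ts. 0 \<le> ts 0 \<and> mono ts \<longrightarrow>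
        prob_space.indep_vars M (\<lambda>_. borel) (\<lambda>i \<omega>. X (ts (Suc i)) \<omega> - X (ts i) \<omega>) {..<n}) \<and>
     (\<forall>s t. 0 \<le> s \<and> s \<le> t \<longrightarrow>
        distr M borel (\<lambda>\<omega>. X t \<omega> - X s \<omega>) = distr M borel (X (t - s))) \<and>
     (AE \<omega> in M. cadlag (\<lambda>t. X t \<omega>))"

text \<open>The normalisation is that of the generator \<open>\<Delta>\<close>, i.e. coordinates have variance \<open>2t\<close>.\<close>

definition brownian_motion :: "'w measure \<Rightarrow> (real \<Rightarrow> 'w \<Rightarrow> 'a::euclidean_space) \<Rightarrow> bool" where
  "brownian_motion M B \<longleftrightarrow>
     levy_process M B \<and>
     (AE \<omega> in M. continuous_on {0..} (\<lambda>t. B t \<omega>)) \<and>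
     (\<forall>t\<ge>0. \<forall>\<xi>. (\<integral>\<omega>. iexp (\<xi> \<bullet> B t \<omega>) \<partial>M) = complex_of_real (exp (- t * (norm \<xi>)\<^sup>2)))"

definition subordinator :: "'w measure \<Rightarrow> (real \<Rightarrow> real) \<Rightarrow> (real \<Rightarrow> 'w \<Rightarrow> real) \<Rightarrow> bool" where
  "subordinator M \<Psi> S \<longleftrightarrow>
     levy_process M S \<and>
     (AE \<omega> in M. mono_on {0..} (\<lambda>t. S t \<omega>)) \<and>
     (\<forall>t\<ge>0. \<forall>u>0. (\<integral>\<omega>. exp (- u * S t \<omega>) \<partial>M) = exp (- t * \<Psi> u))"

definition process_sets :: "'w measure \<Rightarrow> (real \<Rightarrow> 'w \<Rightarrow> 'a::euclidean_space) \<Rightarrow> 'w set set" where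
  "process_sets M X =
     sets (vimage_algebra (space M) (\<lambda>\<omega>. \<lambda>t\<in>{0..}. X t \<omega>) (PiM {0..} (\<lambda>_. borel)))"

definition subordinate_brownian_motion ::
    "'w measure \<Rightarrow> (real \<Rightarrow> real) \<Rightarrow> (real \<Rightarrow> 'w \<Rightarrow> 'a::euclidean_space) \<Rightarrow> bool" where
  "subordinate_brownian_motion M \<Psi> X \<longleftrightarrow>
     (\<exists>B S. brownian_motion M B \<and> subordinator M \<Psi> S \<and>
        prob_space.indep_set M (process_sets M B) (process_sets M S) \<and>
        X = (\<lambda>t \<omega>. B (S t \<omega>) \<omega>))"


section \<open>Exit times and parabolic weak sub-solutions\<close>

text \<open>\<open>\<P>\<^sup>x\<close> is realised as the law under \<open>M\<close> of the translated process.\<close>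

definition started_at :: "'a \<Rightarrow> (real \<Rightarrow> 'w \<Rightarrow> 'a::euclidean_space) \<Rightarrow> real \<Rightarrow> 'w \<Rightarrow> 'a" where
  "started_at x X = (\<lambda>t \<omega>. x + X t \<omega>)"

definition exit_time :: "'a set \<Rightarrow> (real \<Rightarrow> 'w \<Rightarrow> 'a) \<Rightarrow> 'w \<Rightarrow> ereal" where
  "exit_time D Y \<omega> = Inf (ereal ` {t. 0 < t \<and> Y t \<omega> \<notin> D})"

definition capped_exit_time :: "'a set \<Rightarrow> (real \<Rightarrow> 'w \<Rightarrow> 'a) \<Rightarrow> real \<Rightarrow> 'w \<Rightarrow> real" where
  "capped_exit_time D Y r \<omega> = real_of_ereal (min (ereal r) (exit_time D Y \<omega>))"

definition regular_boundary ::
    "'w measure \<Rightarrow> (real \<Rightarrow> 'w \<Rightarrow> 'a::euclidean_space) \<Rightarrow> 'a set \<Rightarrow> bool" where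
  "regular_boundary M X D \<longleftrightarrow>
     (\<forall>z\<in>frontier D. AE \<omega> in M. exit_time D (started_at z X) \<omega> = 0)"

text \<open>Expectations are taken under the completion of \<open>M\<close>, since exit times (debuts) need only be
  measurable with respect to the completed sigma-algebra. Time integrals use \<^const>\<open>lebesgue\<close>, so
  that \<open>V\<close> and \<open>f\<close> may be Lebesgue measurable.\<close>

definition parabolic_weak_subsolution ::
    "'w measure \<Rightarrow> (real \<Rightarrow> 'w \<Rightarrow> 'a::euclidean_space) \<Rightarrow> 'a set \<Rightarrow> (real \<times> 'a \<Rightarrow> real) \<Rightarrow>
     real \<Rightarrow> (real \<times> 'a \<Rightarrow> real) \<Rightarrow> (real \<times> 'a \<Rightarrow> real) \<Rightarrow> bool" where
  "parabolic_weak_subsolution M X D V T f \<phi> \<longleftrightarrow>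
     continuous_on ({0..T} \<times> UNIV) \<phi> \<and>
     (\<forall>t\<in>{0..<T}. \<forall>x\<in>D.
        (let Y = started_at x X;
             \<sigma> = capped_exit_time D Y (T - t);
             weight = (\<lambda>s \<omega>. exp (- (LINT r:{0..s}|lebesgue. V (t + r, Y r \<omega>))))
         in \<phi> (t, x) \<le>
              (\<integral>\<omega>. weight (\<sigma> \<omega>) \<omega> * \<phi> (t + \<sigma> \<omega>, Y (\<sigma> \<omega>) \<omega>) \<partial>completion M) +
              (\<integral>\<omega>. (LINT s:{0..\<sigma> \<omega>}|lebesgue. weight s \<omega> * f (t + s, Y s \<omega>)) \<partial>completion M)))"


section \<open>Lebesgue spaces\<close>

definition in_Lp :: "real \<Rightarrow> 'b::euclidean_space set \<Rightarrow> ('b \<Rightarrow> real) \<Rightarrow> bool" where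
  "in_Lp p Q f \<longleftrightarrow>
     f \<in> borel_measurable (lebesgue_on Q) \<and> integrable (lebesgue_on Q) (\<lambda>z. \<bar>f z\<bar> powr p)"

definition Lp_norm :: "real \<Rightarrow> 'b::euclidean_space set \<Rightarrow> ('b \<Rightarrow> real) \<Rightarrow> real" where
  "Lp_norm p Q f = (\<integral>z. \<bar>f z\<bar> powr p \<partial>lebesgue_on Q) powr (1 / p)"

end

theory Submission
  imports Defs
begin

text \<open>The sub-solution property bounds \<open>\<phi>(t,x)\<close> by a boundary term, controlled by right-continuity of
  the paths, plus the expectation of the integral of \<open>f\<close> along the path up to the exit time.
  At time \<open>s\<close> the law of the process has a density of at most \<open>K s = C * max 1 (s powr - \<delta>)\<close>
  with \<open>\<delta> = d / (2 \<mu>)\<close>, because its characteristic function \<open>exp (- s \<Psi>(|\<xi>|\<^sup>2))\<close> is integrable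
  by the scaling condition. Weighting Young's inequality by \<open>K s\<close>,
  \<open>|f| \<le> a |f|\<^sup>p / K s + b (K s)\<^bsup>p' - 1\<^esup>\<close>, the first summand contributes at most \<open>a \<parallel>f\<parallel>\<^sup>p\<close>
  for every horizon \<open>T\<close>. The second one is integrable near \<open>s = 0\<close> since \<open>\<delta> (p' - 1) < 1\<close>, and for
  large \<open>s\<close> because the survival probability in \<open>D\<close> decays exponentially on the time scale
  \<open>1 / \<Psi>(diam(D)\<^bsup>-2\<^esup>)\<close>. Optimising \<open>a\<close> and \<open>b\<close> gives the estimate.\<close>

section \<open>Density bounds from integrable characteristic functions\<close>

text \<open>Measurability shapes the proof. The sub-solution inequality involves exit times and a
  Lebesgue measurable \<open>f\<close> evaluated along paths, and a Bochner integral is 0 when its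
  integrand is not integrable. Each estimate is therefore carried by a nonnegative integral of an
  explicit measurable majorant, built from a jointly measurable modification \<open>Z\<close> and
  from an event that inspects the path only at multiples of a step \<open>h\<close>. The decay of
  survival comes from independent increments: staying in \<open>D\<close> up to time s forces about
  s/h increments to have length at most the diameter, and the probability that one increment does so
  is at most 1/2 once \<open>h\<close> times \<Psi>(diam^-2) reaches a universal constant \<kappa>.
  Both this bound and the density bound use the Gaussian as a test function whose Fourier transform
  is explicit. The threshold on \<open>p\<close> enters through p' - 1 = 1/(p - 1), which makes p -
  1 > \<delta> the same as \<delta>(p' - 1) < 1. The argument yields the time scale to the power
  1/p'; one plus its power 2/p' dominates this up to a factor.\<close>

lemma (in prob_space) norm_expectation_le:
  fixes f :: "'a \<Rightarrow> 'b::{banach, second_countable_topology}"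
  assumes "AE \<omega> in M. norm (f \<omega>) \<le> B" and "0 \<le> B"
  shows "norm (\<integral>\<omega>. f \<omega> \<partial>M) \<le> B"
proof (cases "integrable M f")
  case True
  then have "norm (\<integral>\<omega>. f \<omega> \<partial>M) \<le> (\<integral>\<omega>. norm (f \<omega>) \<partial>M)"
    by (intro integral_norm_bound)
  also have "\<dots> \<le> B"
    using True assms by (intro integral_le_const) auto
  finally show ?thesis .
\<comment> \<open>A non-integrable function has Bochner integral 0; this is where
  \<open>0 \<le> B\<close> enters.\<close>
qed (simp add: not_integrable_integral_eq assms)

section \<open>The standard Gaussian density and its Fourier transform\<close>

definition gauss :: "'a::euclidean_space \<Rightarrow> real" where
  "gauss w = (\<Prod>b\<in>Basis. std_normal_density (w \<bullet> b))"

lemma gauss_measurable [measurable]: "gauss \<in> borel_measurable borel"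
  unfolding gauss_def by measurable

lemma gauss_nonneg: "0 \<le> gauss w"
  unfolding gauss_def by (intro prod_nonneg) simp

text \<open>Each coordinate carries a factor 1/sqrt(2 pi), which is at most 1 and is dropped. What
  remains is the function that \<open>gauss_char\<close> produces as the transform of
  \<open>gauss\<close>, so the loss affects constants only.\<close>

lemma gauss_le: "gauss (w::'a::euclidean_space) \<le> exp (- (norm w)\<^sup>2 / 2)"
proof -
  have "gauss w \<le> (\<Prod>b\<in>(Basis::'a set). exp (- (w \<bullet> b)\<^sup>2 / 2))"
    unfolding gauss_def
  proof (intro prod_mono conjI)
    fix b :: 'a
    have "1 \<le> 2 * pi" using pi_ge_two by linarith
    then have "1 / sqrt (2 * pi) \<le> 1" by simp
    then show "std_normal_density (w \<bullet> b) \<le> exp (- (w \<bullet> b)\<^sup>2 / 2)"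
      unfolding std_normal_density_def by (intro mult_left_le_one_le) auto
  qed simp
  also have "\<dots> = exp (\<Sum>b\<in>(Basis::'a set). - (w \<bullet> b)\<^sup>2 / 2)"
    by (simp add: exp_sum)
  also have "(\<Sum>b\<in>(Basis::'a set). - (w \<bullet> b)\<^sup>2 / 2) = - (norm w)\<^sup>2 / 2"
    unfolding power2_norm_eq_inner by (subst euclidean_inner) (simp add: power2_eq_square sum_divide_distrib sum_negf)
  finally show ?thesis .
qed

lemma gauss_le_1: "gauss w \<le> 1"
  using gauss_le[of w] by (rule order_trans) simp

lemma nn_integral_gauss: "(\<integral>\<^sup>+w. ennreal (gauss w) \<partial>lborel) = 1"
proof -
  have "(\<integral>\<^sup>+w. ennreal (gauss (w::'a)) \<partial>lborel)
      = (\<integral>\<^sup>+w. (\<Prod>b\<in>Basis. ennreal (std_normal_density (w \<bullet> (b::'a)))) \<partial>lborel)"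
    unfolding gauss_def by (intro nn_integral_cong prod_ennreal[symmetric]) simp
  also have "\<dots> = (\<Prod>b\<in>(Basis::'a set). \<integral>\<^sup>+x. ennreal (std_normal_density x) \<partial>lborel)"
    by (rule nn_integral_lborel_prod) auto
  also have "(\<integral>\<^sup>+x. ennreal (std_normal_density x) \<partial>lborel) = 1"
    using prob_space.emeasure_space_1[OF prob_space_normal_density[of 1 0]]
    by (simp add: emeasure_density)
  finally show ?thesis by simp
qed

lemma integrable_gauss: "integrable lborel gauss"
proof (rule integrableI_nonneg)
  show "(\<integral>\<^sup>+w. ennreal (gauss (w::'a::euclidean_space)) \<partial>lborel) < \<infinity>"
    unfolding nn_integral_gauss by simp
qed (simp_all add: gauss_nonneg)

lemma gauss_char:
  "(\<integral>w. complex_of_real (gauss w) * iexp (z \<bullet> w) \<partial>lborel) = complex_of_real (exp (- (norm (z::'a::euclidean_space))\<^sup>2 / 2))"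
proof -
  interpret product_sigma_finite "\<lambda>_::'a. lborel :: real measure" ..
  have 1: "(\<integral>x. complex_of_real (std_normal_density x) * iexp (t * x) \<partial>lborel) = complex_of_real (exp (- t\<^sup>2 / 2))" for t
  proof -
    have "char std_normal_distribution t = complex_of_real (exp (- (t^2) / 2))"
      by (simp add: char_std_normal_distribution)
    then show ?thesis
      unfolding char_def by (subst (asm) integral_density) (auto simp: scaleR_conv_of_real)
  qed
  have int: "integrable lborel (\<lambda>x. complex_of_real (std_normal_density x) * iexp (t * x))" for t
  proof (rule Bochner_Integration.integrable_bound[OF integrable_std_normal_moment[of 0]])
    show "(\<lambda>x. complex_of_real (std_normal_density x) * iexp (t * x)) \<in> borel_measurable lborel"
      by measurable
    show "AE x in lborel. norm (complex_of_real (std_normal_density x) * iexp (t * x)) \<le> norm (std_normal_density x * x ^ 0)"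
      by (simp add: norm_mult)
  qed
  have "(\<integral>w. complex_of_real (gauss w) * iexp (z \<bullet> w) \<partial>lborel)
      = (\<integral>f. (\<Prod>b\<in>Basis. complex_of_real (std_normal_density (f b)) * iexp ((z \<bullet> b) * f b)) \<partial>(\<Pi>\<^sub>M b\<in>Basis. lborel))"
    by (subst lborel_eq, subst integral_distr)
       (auto intro!: Bochner_Integration.integral_cong
          simp: gauss_def prod.distrib inner_sum_right inner_sum_left inner_Basis mult.commute
             if_distrib sum_distrib_left sum_distrib_right exp_sum cong: if_cong)
  also have "\<dots> = (\<Prod>b\<in>Basis. complex_of_real (exp (- (z \<bullet> b)\<^sup>2 / 2)))"
    by (subst product_integral_prod) (simp_all only: finite_Basis int 1)
  also have "\<dots> = complex_of_real (exp (\<Sum>b\<in>(Basis::'a set). - (z \<bullet> b)\<^sup>2 / 2))"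
    by (simp add: exp_sum)
  also have "(\<Sum>b\<in>(Basis::'a set). - (z \<bullet> b)\<^sup>2 / 2) = - (norm z)\<^sup>2 / 2"
    unfolding power2_norm_eq_inner by (subst euclidean_inner) (simp add: power2_eq_square sum_divide_distrib sum_negf)
  finally show ?thesis .
qed

lemma nn_integral_lborel_affine:
  fixes f :: "'a::euclidean_space \<Rightarrow> ennreal"
  assumes [measurable]: "f \<in> borel_measurable borel" and "c \<noteq> 0"
  shows "(\<integral>\<^sup>+x. f x \<partial>lborel) = ennreal (\<bar>c\<bar> ^ DIM('a)) * (\<integral>\<^sup>+x. f (t + c *\<^sub>R x) \<partial>lborel)"
  by (subst lborel_affine[OF \<open>c \<noteq> 0\<close>, of t])
     (simp add: nn_integral_density nn_integral_distr nn_integral_cmult)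

text \<open>With z = (Y - y)/\<epsilon>, the function exp(-|z|^2/2) is the Fourier transform of
  \<open>gauss\<close> at z. Fubini moves the expectation inside, where it becomes the
  characteristic function of \<open>Y\<close> at w/\<epsilon> times a unimodular factor. Bounding
  \<open>gauss\<close> by 1 and substituting \<xi> = w/\<epsilon> produces the factor
  \<epsilon>^d.\<close>

lemma emeasure_le_char_integral_mollified:
  fixes Y :: "'w \<Rightarrow> 'a::euclidean_space"
  assumes "prob_space M" and [measurable]: "Y \<in> borel_measurable M" and [measurable]: "\<psi> \<in> borel_measurable borel"
    and ch: "AE \<xi> in lborel. ennreal (norm (\<integral>\<omega>. iexp (\<xi> \<bullet> Y \<omega>) \<partial>M)) \<le> \<psi> \<xi>"
    and "\<epsilon> > 0"
  shows "(\<integral>\<^sup>+\<omega>. ennreal (exp (- (norm ((1 / \<epsilon>) *\<^sub>R (Y \<omega> - y)))\<^sup>2 / 2)) \<partial>M) \<le> ennreal (\<epsilon> ^ DIM('a)) * (\<integral>\<^sup>+\<xi>. \<psi> \<xi> \<partial>lborel)"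
proof -
  interpret prob_space M by fact
  interpret pair_sigma_finite M "lborel :: 'a measure" ..
  let ?g = "\<lambda>\<omega> w. complex_of_real (gauss w) * iexp (((1 / \<epsilon>) *\<^sub>R (Y \<omega> - y)) \<bullet> w)"
  have intg: "integrable (M \<Otimes>\<^sub>M lborel) (\<lambda>(\<omega>, w). ?g \<omega> w)"
  proof (rule Fubini_integrable)
    show "AE \<omega> in M. integrable lborel (\<lambda>w. case (\<omega>, w) of (\<omega>, w) \<Rightarrow> ?g \<omega> w)"
      by (intro AE_I2 Bochner_Integration.integrable_bound[OF integrable_gauss]) (auto simp: norm_mult gauss_nonneg)
  qed (auto simp: norm_mult gauss_nonneg)
  have "complex_of_real (\<integral>\<omega>. exp (- (norm ((1 / \<epsilon>) *\<^sub>R (Y \<omega> - y)))\<^sup>2 / 2) \<partial>M)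
      = (\<integral>\<omega>. \<integral>w. ?g \<omega> w \<partial>lborel \<partial>M)"
    by (simp only: gauss_char integral_complex_of_real)
  also have "\<dots> = (\<integral>w. \<integral>\<omega>. ?g \<omega> w \<partial>M \<partial>lborel)"
    using Fubini_integral[of ?g] intg by simp
  also have "\<dots> = (\<integral>w. complex_of_real (gauss w) * iexp (- ((1 / \<epsilon>) *\<^sub>R y \<bullet> w)) * (\<integral>\<omega>. iexp (((1 / \<epsilon>) *\<^sub>R w) \<bullet> Y \<omega>) \<partial>M) \<partial>lborel)"
    (is "_ = integral\<^sup>L _ ?h")
    by (intro Bochner_Integration.integral_cong refl, subst integral_mult_right_zero[symmetric],
        intro Bochner_Integration.integral_cong refl)
       (simp add: mult.assoc exp_add[symmetric] algebra_simps inner_diff_left diff_divide_distrib inner_commute)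
  finally have eq: "complex_of_real (\<integral>\<omega>. exp (- (norm ((1 / \<epsilon>) *\<^sub>R (Y \<omega> - y)))\<^sup>2 / 2) \<partial>M) = integral\<^sup>L lborel ?h" .
  have int: "integrable lborel ?h"
  proof (rule Bochner_Integration.integrable_bound[OF integrable_gauss])
    show "AE w in lborel. norm (?h w) \<le> norm (gauss w)"
    proof (intro AE_I2)
      fix w :: 'a
      have "norm (\<integral>\<omega>. iexp (((1 / \<epsilon>) *\<^sub>R w) \<bullet> Y \<omega>) \<partial>M) \<le> 1"
        by (rule norm_expectation_le) auto
      then have "gauss w * norm (\<integral>\<omega>. iexp (((1 / \<epsilon>) *\<^sub>R w) \<bullet> Y \<omega>) \<partial>M) \<le> gauss w * 1"
        by (intro mult_left_mono) (auto simp: prob_space gauss_nonneg)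
      then show "norm (?h w) \<le> norm (gauss w)"
        by (simp add: norm_mult gauss_nonneg)
    qed
  qed measurable
  have "(\<integral>\<^sup>+\<omega>. ennreal (exp (- (norm ((1 / \<epsilon>) *\<^sub>R (Y \<omega> - y)))\<^sup>2 / 2)) \<partial>M)
     = ennreal (\<integral>\<omega>. exp (- (norm ((1 / \<epsilon>) *\<^sub>R (Y \<omega> - y)))\<^sup>2 / 2) \<partial>M)"
    by (intro nn_integral_eq_integral integrable_const_bound[where B=1]) auto
  also have "\<dots> = ennreal (norm (integral\<^sup>L lborel ?h))"
    unfolding eq[symmetric] norm_of_real by (subst abs_of_nonneg) (auto intro!: integral_nonneg_AE)
  also have "\<dots> \<le> (\<integral>\<^sup>+w. ennreal (norm (?h w)) \<partial>lborel)"
    by (rule integral_norm_bound_ennreal[OF int])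
  also have "\<dots> \<le> (\<integral>\<^sup>+w. \<psi> (0 + (1 / \<epsilon>) *\<^sub>R w) \<partial>lborel)"
  proof (rule nn_integral_mono_AE)
    \<comment> \<open>The hypothesis on \<psi> holds only almost everywhere in \<xi>. Writing
      \<open>lborel\<close> as a rescaled image of itself carries the exceptional null set over to
      the variable w = \<epsilon> \<xi>.\<close>
    have "AE \<xi> in density (distr lborel borel (\<lambda>x. 0 + (1 / \<epsilon>) *\<^sub>R x)) (\<lambda>_. ennreal (\<bar>1 / \<epsilon>\<bar> ^ DIM('a))).
        ennreal (norm (\<integral>\<omega>. iexp (\<xi> \<bullet> Y \<omega>) \<partial>M)) \<le> \<psi> \<xi>"
      using ch \<open>\<epsilon> > 0\<close> by (subst lborel_affine[symmetric]) auto
    then have "AE w in lborel. ennreal (norm (\<integral>\<omega>. iexp ((0 + (1 / \<epsilon>) *\<^sub>R w) \<bullet> Y \<omega>) \<partial>M)) \<le> \<psi> (0 + (1 / \<epsilon>) *\<^sub>R w)"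
      using \<open>\<epsilon> > 0\<close> by (simp add: AE_density AE_distr_iff)
    then show "AE w in lborel. ennreal (norm (?h w)) \<le> \<psi> (0 + (1 / \<epsilon>) *\<^sub>R w)"
    proof eventually_elim
      case (elim w)
      have "norm (?h w) \<le> 1 * norm (\<integral>\<omega>. iexp ((0 + (1 / \<epsilon>) *\<^sub>R w) \<bullet> Y \<omega>) \<partial>M)"
        by (simp add: norm_mult gauss_nonneg gauss_le_1 mult_left_le_one_le)
      then have "ennreal (norm (?h w)) \<le> ennreal (norm (\<integral>\<omega>. iexp ((0 + (1 / \<epsilon>) *\<^sub>R w) \<bullet> Y \<omega>) \<partial>M))"
        by (simp add: ennreal_leI)
      then show ?case
        using elim by (rule order_trans)
    qed
  qed
  also have "\<dots> = ennreal (\<epsilon> ^ DIM('a)) * (\<integral>\<^sup>+\<xi>. \<psi> \<xi> \<partial>lborel)"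
    using \<open>\<epsilon> > 0\<close> by (subst (2) nn_integral_lborel_affine[where c="1 / \<epsilon>" and t=0])
      (auto simp: mult.assoc[symmetric] ennreal_mult[symmetric] power_one_over)
  finally show ?thesis .
qed

text \<open>Fourier inversion in the form of a domination of measures, up to the power of 2 pi that
  the cruder Gaussian bounds give away. \<open>Y\<close> is perturbed by \<epsilon> times an
  independent Gaussian, for which the bound is uniform in \<epsilon>; Fatou's lemma removes the
  perturbation on open sets, and outer regularity passes to Borel sets.\<close>

lemma emeasure_le_char_integral:
  fixes Y :: "'w \<Rightarrow> 'a::euclidean_space"
  assumes M: "prob_space M" and Y[measurable]: "Y \<in> borel_measurable M" and \<psi>[measurable]: "\<psi> \<in> borel_measurable borel"
    and ch: "AE \<xi> in lborel. ennreal (norm (\<integral>\<omega>. iexp (\<xi> \<bullet> Y \<omega>) \<partial>M)) \<le> \<psi> \<xi>"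
    and fin: "(\<integral>\<^sup>+\<xi>. \<psi> \<xi> \<partial>lborel) < \<infinity>"
    and A: "A \<in> sets borel"
  shows "emeasure (distr M borel Y) A \<le> (\<integral>\<^sup>+\<xi>. \<psi> \<xi> \<partial>lborel) * emeasure lborel A"
proof -
  interpret prob_space M by fact
  interpret pair_sigma_finite M "lborel :: 'a measure" ..
  let ?I = "\<integral>\<^sup>+\<xi>. \<psi> \<xi> \<partial>lborel"
  have moll: "(\<integral>\<^sup>+\<omega>. \<integral>\<^sup>+w. indicator U (Y \<omega> + \<epsilon> *\<^sub>R w) * ennreal (gauss w) \<partial>lborel \<partial>M) \<le> ?I * emeasure lborel U"
    if [measurable]: "U \<in> sets borel" and "\<epsilon> > 0" for U \<epsilon>
  proof -
    \<comment> \<open>The factor \<epsilon>^d is the Jacobian of the substitution y = Y + \<epsilon>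
      w. It is cancelled at the end against the same factor in the mollified bound.\<close>
    have "ennreal (\<epsilon> ^ DIM('a)) * (\<integral>\<^sup>+\<omega>. \<integral>\<^sup>+w. indicator U (Y \<omega> + \<epsilon> *\<^sub>R w) * ennreal (gauss w) \<partial>lborel \<partial>M)
        = (\<integral>\<^sup>+\<omega>. ennreal (\<epsilon> ^ DIM('a)) * (\<integral>\<^sup>+w. indicator U (Y \<omega> + \<epsilon> *\<^sub>R w) * ennreal (gauss w) \<partial>lborel) \<partial>M)"
      by (subst nn_integral_cmult) auto
    also have "\<dots> = (\<integral>\<^sup>+\<omega>. \<integral>\<^sup>+y. indicator U y * ennreal (gauss ((1 / \<epsilon>) *\<^sub>R (y - Y \<omega>))) \<partial>lborel \<partial>M)"
    proof (intro nn_integral_cong)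
      fix \<omega>
      show "ennreal (\<epsilon> ^ DIM('a)) * (\<integral>\<^sup>+w. indicator U (Y \<omega> + \<epsilon> *\<^sub>R w) * ennreal (gauss w) \<partial>lborel)
          = (\<integral>\<^sup>+y. indicator U y * ennreal (gauss ((1 / \<epsilon>) *\<^sub>R (y - Y \<omega>))) \<partial>lborel)"
        using \<open>\<epsilon> > 0\<close>
        by (subst nn_integral_lborel_affine[where f="\<lambda>y. indicator U y * ennreal (gauss ((1 / \<epsilon>) *\<^sub>R (y - Y \<omega>)))" and c=\<epsilon> and t="Y \<omega>"]) auto
    qed
    also have "\<dots> \<le> (\<integral>\<^sup>+\<omega>. \<integral>\<^sup>+y. indicator U y * ennreal (exp (- (norm ((1 / \<epsilon>) *\<^sub>R (Y \<omega> - y)))\<^sup>2 / 2)) \<partial>lborel \<partial>M)"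
    proof (intro nn_integral_mono mult_left_mono ennreal_leI)
      fix \<omega> y
      show "gauss ((1 / \<epsilon>) *\<^sub>R (y - Y \<omega>)) \<le> exp (- (norm ((1 / \<epsilon>) *\<^sub>R (Y \<omega> - y)))\<^sup>2 / 2)"
        using gauss_le[of "(1 / \<epsilon>) *\<^sub>R (y - Y \<omega>)"] by (simp add: norm_minus_commute)
    qed auto
    also have "\<dots> = (\<integral>\<^sup>+y. \<integral>\<^sup>+\<omega>. indicator U y * ennreal (exp (- (norm ((1 / \<epsilon>) *\<^sub>R (Y \<omega> - y)))\<^sup>2 / 2)) \<partial>M \<partial>lborel)"
      by (rule Fubini'[symmetric]) measurable
    also have "\<dots> \<le> (\<integral>\<^sup>+y. indicator U y * (ennreal (\<epsilon> ^ DIM('a)) * ?I) \<partial>lborel)"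
      using emeasure_le_char_integral_mollified[OF M Y \<psi> ch \<open>\<epsilon> > 0\<close>]
      by (intro nn_integral_mono) (auto simp: nn_integral_cmult intro!: mult_left_mono)
    also have "\<dots> = ennreal (\<epsilon> ^ DIM('a)) * (?I * emeasure lborel U)"
      by (simp add: nn_integral_multc mult_ac)
    finally show ?thesis
      using \<open>\<epsilon> > 0\<close> by (subst (asm) ennreal_mult_le_mult_iff) auto
  qed
  have opn: "emeasure (distr M borel Y) U \<le> ?I * emeasure lborel U" if "open U" for U
  proof -
    have [measurable]: "U \<in> sets borel" using that by simp
    let ?e = "\<lambda>n::nat. 1 / real (Suc n)"
    let ?F = "\<lambda>n \<omega> w. indicator U (Y \<omega> + ?e n *\<^sub>R w) * ennreal (gauss w)"
    have "emeasure (distr M borel Y) U = (\<integral>\<^sup>+\<omega>. indicator U (Y \<omega>) \<partial>M)"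
      by (simp add: nn_integral_distr flip: nn_integral_indicator)
    also have "\<dots> = (\<integral>\<^sup>+\<omega>. \<integral>\<^sup>+w. indicator U (Y \<omega>) * ennreal (gauss (w::'a)) \<partial>lborel \<partial>M)"
      by (simp add: nn_integral_cmult nn_integral_gauss)
    \<comment> \<open>Openness of \<open>U\<close> is what makes this work: if Y lies in
      \<open>U\<close>, so does Y + w/(n+1) for all large n, so the indicator is lower
      semicontinuous along the sequence. Fatou is then applied once in w and once in
      \<omega>.\<close>
    also have "\<dots> \<le> (\<integral>\<^sup>+\<omega>. \<integral>\<^sup>+w. liminf (\<lambda>n. ?F n \<omega> w) \<partial>lborel \<partial>M)"
    proof (intro nn_integral_mono)
      fix \<omega> w
      have lim: "(\<lambda>n. Y \<omega> + ?e n *\<^sub>R w) \<longlonglongrightarrow> Y \<omega> + 0 *\<^sub>R w"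
        by (intro tendsto_intros LIMSEQ_Suc lim_1_over_n)
      show "indicator U (Y \<omega>) * ennreal (gauss w) \<le> liminf (\<lambda>n. ?F n \<omega> w)"
      proof (cases "Y \<omega> \<in> U")
        case True
        have "\<forall>\<^sub>F n in sequentially. Y \<omega> + ?e n *\<^sub>R w \<in> U"
          using topological_tendstoD[OF lim \<open>open U\<close>] True by simp
        then show ?thesis
          by (intro Liminf_bounded) (auto simp: True elim!: eventually_mono)
      qed simp
    qed
    also have "\<dots> \<le> (\<integral>\<^sup>+\<omega>. liminf (\<lambda>n. \<integral>\<^sup>+w. ?F n \<omega> w \<partial>lborel) \<partial>M)"
      by (intro nn_integral_mono nn_integral_liminf) simp
    also have "\<dots> \<le> liminf (\<lambda>n. \<integral>\<^sup>+\<omega>. \<integral>\<^sup>+w. ?F n \<omega> w \<partial>lborel \<partial>M)"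
      by (intro nn_integral_liminf) simp
    also have "\<dots> \<le> ?I * emeasure lborel U"
      by (intro Liminf_le always_eventually allI moll) auto
    finally show ?thesis .
  qed
  \<comment> \<open>In \<open>ennreal\<close> the product of 0 and \<infinity> is 0, so
    \<open>?I = 0\<close> needs its own argument, by the open set \<open>UNIV\<close>; with
    \<open>?I\<close> positive, infinite volume makes the claim trivial. In the remaining case the
    approximation error \<open>e / i\<close> is a positive real.\<close>
  show ?thesis
  proof (cases "?I = 0 \<or> emeasure lborel A = \<infinity>")
    case True
    show ?thesis
    proof (cases "?I = 0")
      case True
      have "emeasure (distr M borel Y) A \<le> emeasure (distr M borel Y) UNIV"
        by (intro emeasure_mono) auto
      also have "\<dots> \<le> 0"
        using opn[of UNIV] True by simp
      finally show ?thesis by simp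
    next
      case False
      with True show ?thesis by (simp add: ennreal_mult_top)
    qed
  next
    case False
    then obtain i a where i: "?I = ennreal i" "i > 0" and a: "emeasure lborel A = ennreal a" "a \<ge> 0"
      using fin by (cases ?I; cases "emeasure lborel A") (auto simp: less_le)
    show ?thesis
    proof (rule ennreal_le_epsilon)
      fix e :: real assume "e > 0"
      then obtain U where U: "open U" "A \<subseteq> U" "emeasure lborel (U - A) < ennreal (e / i)"
        using outer_regular_lborel[OF A, of "e / i"] i by auto
      have "emeasure lborel U = emeasure lborel A + emeasure lborel (U - A)"
        using U A by (subst plus_emeasure) (auto simp: Un_absorb1)
      also have "\<dots> \<le> ennreal a + ennreal (e / i)"
        using U a by (intro add_mono) auto
      finally have "?I * emeasure lborel U \<le> ennreal i * (ennreal a + ennreal (e / i))"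
        unfolding i by (intro mult_left_mono) auto
      also have "\<dots> = ?I * emeasure lborel A + ennreal e"
        unfolding i a using i a \<open>e > 0\<close> by (simp add: ennreal_mult[symmetric] distrib_left flip: ennreal_plus)
      finally have "?I * emeasure lborel U \<le> ?I * emeasure lborel A + ennreal e" .
      moreover have "emeasure (distr M borel Y) A \<le> emeasure (distr M borel Y) U"
        using U by (intro emeasure_mono) auto
      ultimately show "emeasure (distr M borel Y) A \<le> ?I * emeasure lborel A + ennreal e"
        using opn[OF U(1)] by (meson order_trans)
    qed
  qed
qed

section \<open>Estimates for the Laplace exponent\<close>

lemma nn_integral_exp_tail: "(\<integral>\<^sup>+r. ennreal (exp (- r)) * indicator {b..} r \<partial>lborel) = ennreal (exp (- b))"
proof -
  have "(\<integral>\<^sup>+r. ennreal (exp (- r)) * indicator {b..} r \<partial>lborel) = ennreal (0 - (- exp (- b)))"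
  proof (rule nn_integral_FTC_atLeast)
    have "((\<lambda>r::real. - exp (- r)) \<longlongrightarrow> - 0) at_top"
      by (intro tendsto_minus filterlim_compose[OF exp_at_bot filterlim_uminus_at_bot_at_top])
    then show "((\<lambda>r::real. - exp (- r)) \<longlongrightarrow> 0) at_top" by simp
  qed (auto intro!: derivative_eq_intros)
  then show ?thesis by simp
qed

text \<open>Layer cake: \<open>exp (- x)\<close> is the integral of \<open>exp (- r)\<close> over \<open>r \<ge> x\<close>, and the sublevel sets are balls.\<close>

lemma nn_integral_exp_norm_powr:
  assumes "\<nu> > 0" "a > 0"
  defines "\<delta> \<equiv> real DIM('a) / \<nu>"
  shows "(\<integral>\<^sup>+\<xi>. ennreal (exp (- a * norm (\<xi>::'a::euclidean_space) powr \<nu>)) \<partial>lborel)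
    \<le> ennreal (unit_ball_vol DIM('a) * Gamma (\<delta> + 1) * a powr - \<delta>)"
proof -
  have \<delta>: "\<delta> > 0" using assms by (simp add: \<delta>_def)
  have "(\<integral>\<^sup>+\<xi>. ennreal (exp (- a * norm (\<xi>::'a) powr \<nu>)) \<partial>lborel)
      = (\<integral>\<^sup>+\<xi>. \<integral>\<^sup>+r. ennreal (exp (- r)) * indicator {a * norm (\<xi>::'a) powr \<nu>..} r \<partial>lborel \<partial>lborel)"
    by (simp add: nn_integral_exp_tail)
  also have "\<dots> = (\<integral>\<^sup>+r. \<integral>\<^sup>+\<xi>. ennreal (exp (- r)) * indicator {a * norm (\<xi>::'a) powr \<nu>..} r \<partial>lborel \<partial>lborel)"
    by (rule lborel_pair.Fubini'[symmetric]) (simp add: indicator_def)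
  \<comment> \<open>The sublevel set is a ball of radius (r/a)^(1/\<nu>), whose volume is
    proportional to (r/a)^\<delta>. The integrand is written in the shape of Euler's integral for
    Gamma(\<delta> + 1).\<close>
  also have "\<dots> \<le> (\<integral>\<^sup>+r. ennreal (unit_ball_vol DIM('a) * a powr - \<delta>) * ennreal (indicator {0..} r * r powr (\<delta> + 1 - 1) / exp r) \<partial>lborel)"
  proof (rule nn_integral_mono)
    fix r :: real
    show "(\<integral>\<^sup>+\<xi>. ennreal (exp (- r)) * indicator {a * norm (\<xi>::'a) powr \<nu>..} r \<partial>lborel)
        \<le> ennreal (unit_ball_vol DIM('a) * a powr - \<delta>) * ennreal (indicator {0..} r * r powr (\<delta> + 1 - 1) / exp r)"
    proof (cases "r \<ge> 0")
      case True
      let ?R = "(r / a) powr (1 / \<nu>)"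
      have "norm \<xi> \<le> ?R" if "a * norm (\<xi>::'a) powr \<nu> \<le> r" for \<xi>
      proof -
        have "norm \<xi> powr \<nu> \<le> r / a" using that assms by (simp add: field_simps)
        then have "(norm \<xi> powr \<nu>) powr (1 / \<nu>) \<le> ?R"
          using assms by (intro powr_mono2) auto
        then show ?thesis using assms by (simp add: powr_powr)
      qed
      then have "(\<integral>\<^sup>+\<xi>. ennreal (exp (- r)) * indicator {a * norm (\<xi>::'a) powr \<nu>..} r \<partial>lborel)
          \<le> (\<integral>\<^sup>+\<xi>. ennreal (exp (- r)) * indicator (cball (0::'a) ?R) \<xi> \<partial>lborel)"
        by (intro nn_integral_mono mult_left_mono) (auto simp: indicator_def)
      also have "\<dots> = ennreal (exp (- r)) * ennreal (unit_ball_vol DIM('a) * ?R ^ DIM('a))"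
        by (subst nn_integral_cmult_indicator) (simp_all add: emeasure_cball)
      also have "?R ^ DIM('a) = (r / a) powr \<delta>"
        unfolding \<delta>_def by (cases "r = 0") (use True assms in \<open>simp_all add: powr_powr flip: powr_realpow\<close>)
      also have "(r / a) powr \<delta> = r powr \<delta> * a powr - \<delta>"
        using True assms by (simp add: powr_divide powr_minus field_simps)
      also have "ennreal (exp (- r)) * ennreal (unit_ball_vol DIM('a) * (r powr \<delta> * a powr - \<delta>))
          = ennreal (unit_ball_vol DIM('a) * a powr - \<delta>) * ennreal (indicator {0..} r * r powr (\<delta> + 1 - 1) / exp r)"
        using True by (simp add: ennreal_mult[symmetric] unit_ball_vol_nonneg exp_minus field_simps)
      finally show ?thesis .
    next
      case False
      moreover have "0 \<le> a * norm \<xi> powr \<nu>" for \<xi> :: 'a using assms by simp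
      ultimately have "\<not> a * norm \<xi> powr \<nu> \<le> r" for \<xi> :: 'a by (meson order_trans)
      then show ?thesis by simp
    qed
  qed
  also have "\<dots> = ennreal (unit_ball_vol DIM('a) * a powr - \<delta>) * ennreal (Gamma (\<delta> + 1))"
    using \<delta> by (subst nn_integral_cmult) (simp_all add: Gamma_conv_nn_integral_real)
  also have "\<dots> = ennreal (unit_ball_vol DIM('a) * Gamma (\<delta> + 1) * a powr - \<delta>)"
    using \<delta> by (simp add: ennreal_mult[symmetric] unit_ball_vol_nonneg Gamma_real_pos less_imp_le mult_ac)
  finally show ?thesis .
qed

text \<open>Scaling from one base point gives \<Psi>(u) \<ge> \<kappa> u^\<mu> beyond it. Inside the
  corresponding ball the exponential is at most 1, which contributes a constant; outside, the
  stretched exponential integral contributes s^(-\<delta>). Together they explain the form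
  \<open>max 1 (s powr - \<delta>)\<close>. A Borel majorant is supplied because \<Psi> is not
  assumed measurable here, and \<xi> = 0 is excluded because \<Psi>(0) is unconstrained.\<close>

lemma exp_symbol_integral_bound:
  assumes wls: "weak_lower_scaling \<Psi> \<mu> c \<theta>" and "\<mu> > 0" "c > 0" "\<theta> \<ge> 0"
    and pos: "\<And>u. u > 0 \<Longrightarrow> 0 < \<Psi> u"
  defines "\<delta> \<equiv> real DIM('a::euclidean_space) / (2 * \<mu>)"
  shows "\<exists>C>0. \<forall>s>0. \<exists>\<psi>\<in>borel_measurable borel.
    (\<forall>\<xi>::'a. \<xi> \<noteq> 0 \<longrightarrow> ennreal (exp (- s * \<Psi> ((norm \<xi>)\<^sup>2))) \<le> \<psi> \<xi>) \<and>
    (\<integral>\<^sup>+\<xi>. \<psi> \<xi> \<partial>lborel) \<le> ennreal (C * max 1 (s powr - \<delta>))"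
proof -
  \<comment> \<open>Scaling is available only strictly above \<theta>, so \<theta> + 1 serves as
    base point. The constant \<kappa> results from the factor \<gamma> = |\<xi>|^2/(\<theta> +
    1).\<close>
  let ?t = "\<theta> + 1"
  define \<kappa> where "\<kappa> = c * \<Psi> ?t * ?t powr - \<mu>"
  have \<kappa>: "\<kappa> > 0" using assms unfolding \<kappa>_def by simp
  let ?V = "unit_ball_vol DIM('a) * sqrt ?t ^ DIM('a)"
  let ?G = "unit_ball_vol DIM('a) * Gamma (\<delta> + 1)"
  have \<delta>: "\<delta> > 0" unfolding \<delta>_def using assms by simp
  have V: "0 \<le> ?V" using assms by (simp add: unit_ball_vol_nonneg)
  have G: "0 \<le> ?G" using \<delta> by (simp add: unit_ball_vol_nonneg Gamma_real_pos less_imp_le)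
  define C where "C = 1 + ?V + ?G * \<kappa> powr - \<delta>"
  have "C > 0" unfolding C_def using V G by (intro add_pos_nonneg) auto
  moreover have "\<exists>\<psi>\<in>borel_measurable borel.
    (\<forall>\<xi>::'a. \<xi> \<noteq> 0 \<longrightarrow> ennreal (exp (- s * \<Psi> ((norm \<xi>)\<^sup>2))) \<le> \<psi> \<xi>) \<and>
    (\<integral>\<^sup>+\<xi>. \<psi> \<xi> \<partial>lborel) \<le> ennreal (C * max 1 (s powr - \<delta>))" if "s > 0" for s
  proof (intro bexI conjI allI impI)
    let ?\<psi> = "\<lambda>\<xi>::'a. indicator (cball 0 (sqrt ?t)) \<xi> + ennreal (exp (- (s * \<kappa>) * norm \<xi> powr (2 * \<mu>)))"
    show "?\<psi> \<in> borel_measurable borel"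
      by (intro borel_measurable_add borel_measurable_indicator) auto
    fix \<xi> :: 'a
    assume "\<xi> \<noteq> 0"
    show "ennreal (exp (- s * \<Psi> ((norm \<xi>)\<^sup>2))) \<le> ?\<psi> \<xi>"
    proof (cases "norm \<xi> \<le> sqrt ?t")
      case True
      have "0 \<le> s * \<Psi> ((norm \<xi>)\<^sup>2)" using pos[of "(norm \<xi>)\<^sup>2"] \<open>\<xi> \<noteq> 0\<close> \<open>s > 0\<close> by simp
      then have "ennreal (exp (- s * \<Psi> ((norm \<xi>)\<^sup>2))) \<le> ennreal 1" by (intro ennreal_leI) simp
      also have "\<dots> \<le> ?\<psi> \<xi>" using True by simp
      finally show ?thesis .
    next
      case False
      then have "(sqrt ?t)\<^sup>2 \<le> (norm \<xi>)\<^sup>2" using assms by (intro power_mono) auto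
      then have ge: "?t \<le> (norm \<xi>)\<^sup>2" using assms by simp
      have "\<kappa> * norm \<xi> powr (2 * \<mu>) = c * ((norm \<xi>)\<^sup>2 / ?t) powr \<mu> * \<Psi> ?t"
        using assms \<open>\<xi> \<noteq> 0\<close>
        by (simp add: \<kappa>_def powr_divide powr_minus field_simps powr_powr flip: powr_numeral)
      also have "\<dots> \<le> \<Psi> ((norm \<xi>)\<^sup>2 / ?t * ?t)"
        using wls[unfolded weak_lower_scaling_def, rule_format, of ?t "(norm \<xi>)\<^sup>2 / ?t"] ge assms by simp
      also have "(norm \<xi>)\<^sup>2 / ?t * ?t = (norm \<xi>)\<^sup>2" using assms by simp
      finally have "s * (\<kappa> * norm \<xi> powr (2 * \<mu>)) \<le> s * \<Psi> ((norm \<xi>)\<^sup>2)"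
        using \<open>s > 0\<close> by (intro mult_left_mono) auto
      then have "ennreal (exp (- s * \<Psi> ((norm \<xi>)\<^sup>2))) \<le> ennreal (exp (- (s * \<kappa>) * norm \<xi> powr (2 * \<mu>)))"
        by (intro ennreal_leI) (simp add: mult_ac)
      then show ?thesis by (rule order_trans) simp
    qed
  next
    let ?\<psi> = "\<lambda>\<xi>::'a. indicator (cball 0 (sqrt ?t)) \<xi> + ennreal (exp (- (s * \<kappa>) * norm \<xi> powr (2 * \<mu>)))"
    have "(\<integral>\<^sup>+\<xi>. ?\<psi> \<xi> \<partial>lborel) = emeasure lborel (cball (0::'a) (sqrt ?t)) + (\<integral>\<^sup>+\<xi>. ennreal (exp (- (s * \<kappa>) * norm (\<xi>::'a) powr (2 * \<mu>))) \<partial>lborel)"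
      by (subst nn_integral_add) (auto intro!: borel_measurable_indicator)
    also have "\<dots> \<le> ennreal ?V + ennreal (?G * (s * \<kappa>) powr - \<delta>)"
    proof (rule add_mono)
      show "emeasure lborel (cball (0::'a) (sqrt ?t)) \<le> ennreal ?V" 
        using assms by (simp add: emeasure_cball)
      show "(\<integral>\<^sup>+\<xi>. ennreal (exp (- (s * \<kappa>) * norm (\<xi>::'a) powr (2 * \<mu>))) \<partial>lborel) \<le> ennreal (?G * (s * \<kappa>) powr - \<delta>)"
        using nn_integral_exp_norm_powr[of "2 * \<mu>" "s * \<kappa>", where 'a='a] \<open>s > 0\<close> \<kappa> assms by simp
    qed
    also have "\<dots> = ennreal (?V + ?G * \<kappa> powr - \<delta> * s powr - \<delta>)"
    proof -
      have eq: "(s * \<kappa>) powr - \<delta> = \<kappa> powr - \<delta> * s powr - \<delta>"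
        using \<open>s > 0\<close> \<kappa> by (simp add: powr_mult mult.commute)
      have "0 \<le> ?G * \<kappa> powr - \<delta> * s powr - \<delta>"
        by (intro mult_nonneg_nonneg[OF mult_nonneg_nonneg[OF G]]) auto
      then show ?thesis
        unfolding eq mult.assoc[symmetric] by (rule ennreal_plus[OF V, symmetric])
    qed
    also have "\<dots> \<le> ennreal (C * max 1 (s powr - \<delta>))"
    proof (rule ennreal_leI)
      have "?V * 1 + (?G * \<kappa> powr - \<delta>) * s powr - \<delta> \<le> ?V * max 1 (s powr - \<delta>) + (?G * \<kappa> powr - \<delta>) * max 1 (s powr - \<delta>)"
        using V G by (intro add_mono mult_left_mono) auto
      also have "\<dots> \<le> C * max 1 (s powr - \<delta>)"
        unfolding C_def by (simp add: algebra_simps)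
      finally show "?V + ?G * \<kappa> powr - \<delta> * s powr - \<delta> \<le> C * max 1 (s powr - \<delta>)" by simp
    qed
    finally show "(\<integral>\<^sup>+\<xi>. ?\<psi> \<xi> \<partial>lborel) \<le> ennreal (C * max 1 (s powr - \<delta>))" .
  qed
  ultimately show ?thesis by blast
qed

text \<open>For x \<noteq> 0 the integrand vanishes as k grows, and the density dominates it. The
  factor exp(1/2) is the price of bounding the indicator of |y| \<le> R by exp(1/2) exp(-(y/R)^2/2).
  The resulting \<open>k\<close> is a universal constant: the value of time times \<Psi>(R^-2) after
  which one step confines the process with probability at most 1/2.\<close>

lemma exists_small_gaussian_average:
  "\<exists>k>0. exp (1 / 2) * (\<integral>x. std_normal_density x * exp (- k * (min (x\<^sup>2) 1 / 2)) \<partial>lborel) \<le> 1 / 2"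
proof -
  have 0: "(\<lambda>n. \<integral>x. std_normal_density x * exp (- real n * (min (x\<^sup>2) 1 / 2)) \<partial>lborel) \<longlonglongrightarrow> (\<integral>x. (0::real) \<partial>(lborel::real measure))"
  proof (rule integral_dominated_convergence)
    show "integrable lborel std_normal_density"
      using integrable_std_normal_moment[of 0] by simp
    show "AE x in lborel. (\<lambda>n. std_normal_density x * exp (- real n * (min (x\<^sup>2) 1 / 2))) \<longlonglongrightarrow> 0"
      using AE_lborel_singleton[of "0::real"]
    proof eventually_elim
      case (elim x)
      then have "exp (- (min (x\<^sup>2) 1 / 2)) < 1" by (auto simp: min_def)
      then have "(\<lambda>n. exp (- (min (x\<^sup>2) 1 / 2)) ^ n) \<longlonglongrightarrow> 0"
        by (rule LIMSEQ_realpow_zero[OF exp_ge_zero])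
      then have "(\<lambda>n. std_normal_density x * exp (- (min (x\<^sup>2) 1 / 2)) ^ n) \<longlonglongrightarrow> std_normal_density x * 0"
        by (rule tendsto_mult[OF tendsto_const])
      moreover have "exp (- (min (x\<^sup>2) 1 / 2)) ^ n = exp (- real n * (min (x\<^sup>2) 1 / 2))" for n
        using exp_of_nat_mult[of n "- (min (x\<^sup>2) 1 / 2)"] by simp
      ultimately show ?case by simp
    qed
    show "AE x in lborel. norm (std_normal_density x * exp (- real n * (min (x\<^sup>2) 1 / 2))) \<le> std_normal_density x" for n
      by (auto simp: norm_mult intro!: mult_left_le)
  qed measurable
  have "\<forall>\<^sub>F n in sequentially. (\<integral>x. std_normal_density x * exp (- real n * (min (x\<^sup>2) 1 / 2)) \<partial>lborel) < exp (- (1 / 2)) / 2"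
    using 0 by (rule order_tendstoD) simp
  then have "\<forall>\<^sub>F n in sequentially. n > 0 \<and> (\<integral>x. std_normal_density x * exp (- real n * (min (x\<^sup>2) 1 / 2)) \<partial>lborel) < exp (- (1 / 2)) / 2"
    using eventually_gt_at_top[of 0] by eventually_elim simp
  then obtain n :: nat where "n > 0" "(\<integral>x. std_normal_density x * exp (- real n * (min (x\<^sup>2) 1 / 2)) \<partial>lborel) < exp (- (1 / 2)) / 2"
    using eventually_happens'[OF sequentially_bot] by blast
  then show ?thesis
    by (intro exI[of _ "real n"]) (simp add: exp_minus field_simps)
qed

text \<open>Concavity and nonnegativity. The concave function lives on the open half line, so the
  chord starts at a u / 2 instead of 0; this costs the factor 2.\<close>

lemma bernstein0_scaling:
  assumes "bernstein0 \<Psi>" "0 < a" "a \<le> 1" "0 < u"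
  shows "a / 2 * \<Psi> u \<le> \<Psi> (a * u)"
proof -
  have smooth: "(deriv ^^ n) \<Psi> field_differentiable at x" if "x > 0" for n x
    using assms(1) that unfolding bernstein0_def smooth_on_pos_def by blast
  have "concave_on {0<..} \<Psi>"
  proof (rule f''_le0_imp_concave)
    fix x :: real assume x: "x \<in> {0<..}"
    show "DERIV \<Psi> x :> deriv \<Psi> x" "DERIV (deriv \<Psi>) x :> deriv (deriv \<Psi>) x"
      using smooth[of x 0] smooth[of x 1] x by (auto simp: DERIV_deriv_iff_field_differentiable)
    have "\<forall>n\<ge>1. \<forall>u>0. (-1) ^ n * (deriv ^^ n) \<Psi> u \<le> 0"
      using assms(1) by (simp add: bernstein0_def)
    from this[rule_format, of 2 x] x show "deriv (deriv \<Psi>) x \<le> 0"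
      by (simp add: numeral_2_eq_2)
  qed simp
  \<comment> \<open>The solution of (1 - l) a/2 + l = a, so that a u is the convex combination of a
    u / 2 and u with weight \<open>l\<close>.\<close>
  moreover define l where "l = (a / 2) / (1 - a / 2)"
  have l: "0 \<le> l" "l \<le> 1" "a / 2 \<le> l"
    using assms by (auto simp: l_def field_simps)
  ultimately have "(1 - l) * \<Psi> (a * u / 2) + l * \<Psi> u \<le> \<Psi> ((1 - l) *\<^sub>R (a * u / 2) + l *\<^sub>R u)"
    using assms unfolding concave_on_iff by (auto simp del: real_scaleR_def)
  also have "(1 - l) *\<^sub>R (a * u / 2) + l *\<^sub>R u = a * u"
  proof -
    have "l * (1 - a / 2) = a / 2" unfolding l_def using assms by (simp only: times_divide_eq_left nonzero_divide_eq_eq)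
    moreover have "(1 - l) *\<^sub>R (a * u / 2) + l *\<^sub>R u = a / 2 * u + (l * (1 - a / 2)) * u"
      by (simp add: field_simps)
    ultimately have "(1 - l) *\<^sub>R (a * u / 2) + l *\<^sub>R u = a / 2 * u + a / 2 * u" by (simp only:)
    then show ?thesis by simp
  qed
  finally have "(1 - l) * \<Psi> (a * u / 2) + l * \<Psi> u \<le> \<Psi> (a * u)" .
  moreover have "0 \<le> \<Psi> (a * u / 2)" "0 \<le> \<Psi> u"
    using assms unfolding bernstein0_def by auto
  then have "0 \<le> (1 - l) * \<Psi> (a * u / 2)" "a / 2 * \<Psi> u \<le> l * \<Psi> u"
    using l by (intro mult_nonneg_nonneg mult_right_mono; simp)+
  ultimately show ?thesis by linarith
qed

lemma bernstein0_pos: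
  assumes "bernstein0 \<Psi>" "strict_mono_on {0<..} \<Psi>" "0 < u"
  shows "0 < \<Psi> u"
proof -
  have "0 \<le> \<Psi> (u / 2)" using assms by (simp add: bernstein0_def)
  also have "\<dots> < \<Psi> u" using assms by (intro strict_mono_onD[OF assms(2)]) auto
  finally show ?thesis .
qed

section \<open>Subordination\<close>

text \<open>Independence factors the expectation and stationarity replaces each increment by the
  value at the time difference. It is applied twice: to \<open>B\<close> along a frozen sequence of
  times given by \<open>S\<close>, and to \<open>S\<close> itself.\<close>

lemma levy_process_product_increments:
  fixes X :: "real \<Rightarrow> 'w \<Rightarrow> 'a::euclidean_space" and F :: "nat \<Rightarrow> 'a \<Rightarrow> complex"
  assumes levy: "levy_process M X" and t: "mono t" "0 \<le> t 0"
    and F[measurable]: "\<And>k. F k \<in> borel_measurable borel" and bnd: "\<And>k x. norm (F k x) \<le> 1"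
  shows "(\<integral>\<omega>. (\<Prod>k<n. F k (X (t (Suc k)) \<omega> - X (t k) \<omega>)) \<partial>M) = (\<Prod>k<n. \<integral>\<omega>. F k (X (t (Suc k) - t k) \<omega>) \<partial>M)"
proof -
  interpret prob_space M using levy by (simp add: levy_process_def)
  have t0: "0 \<le> t k" "t k \<le> t (Suc k)" for k
    using t monoD[OF t(1), of 0 k] monoD[OF t(1), of k "Suc k"] by auto
  have rv[measurable]: "X s \<in> borel_measurable M" if "0 \<le> s" for s
    using levy that by (simp add: levy_process_def)
  have [measurable]: "X (t k) \<in> borel_measurable M" for k using t0 by simp
  have "indep_vars (\<lambda>_. borel) (\<lambda>i \<omega>. X (t (Suc i)) \<omega> - X (t i) \<omega>) {..<n}"
    using levy t unfolding levy_process_def by blast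
  then have ind: "indep_vars (\<lambda>_. borel) (\<lambda>i \<omega>. F i (X (t (Suc i)) \<omega> - X (t i) \<omega>)) {..<n}"
    by (rule indep_vars_compose2) simp
  have "(\<integral>\<omega>. (\<Prod>k<n. F k (X (t (Suc k)) \<omega> - X (t k) \<omega>)) \<partial>M) = (\<Prod>k<n. \<integral>\<omega>. F k (X (t (Suc k)) \<omega> - X (t k) \<omega>) \<partial>M)"
    by (rule indep_vars_lebesgue_integral[OF _ ind]) (auto intro!: integrable_const_bound[where B=1] bnd)
  also have "\<dots> = (\<Prod>k<n. \<integral>\<omega>. F k (X (t (Suc k) - t k) \<omega>) \<partial>M)"
  proof (rule prod.cong[OF refl])
    fix k
    have d: "distr M borel (\<lambda>\<omega>. X (t (Suc k)) \<omega> - X (t k) \<omega>) = distr M borel (X (t (Suc k) - t k))"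
      using levy t0 unfolding levy_process_def by blast
    have "(\<integral>\<omega>. F k (X (t (Suc k)) \<omega> - X (t k) \<omega>) \<partial>M) = (\<integral>x. F k x \<partial>distr M borel (\<lambda>\<omega>. X (t (Suc k)) \<omega> - X (t k) \<omega>))"
      by (subst integral_distr) auto
    also have "\<dots> = (\<integral>\<omega>. F k (X (t (Suc k) - t k) \<omega>) \<partial>M)"
      unfolding d using t0 by (subst integral_distr) auto
    finally show "(\<integral>\<omega>. F k (X (t (Suc k)) \<omega> - X (t k) \<omega>) \<partial>M) = (\<integral>\<omega>. F k (X (t (Suc k) - t k) \<omega>) \<partial>M)" .
  qed
  finally show ?thesis .
qed

section \<open>Rounding random times up to a countable grid\<close>

definition grid :: "nat \<Rightarrow> real \<Rightarrow> real" where
  "grid m v = real (nat \<lceil>real (Suc m) * v\<rceil>) / real (Suc m)"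

lemma grid_nonneg: "0 \<le> grid m v"
  by (simp add: grid_def)

lemma grid_mono: "v \<le> w \<Longrightarrow> grid m v \<le> grid m w"
  unfolding grid_def by (intro divide_right_mono of_nat_mono nat_mono ceiling_mono mult_left_mono) auto

lemma grid_ge: "v \<le> grid m v"
proof -
  have "real (Suc m) * v \<le> real (nat \<lceil>real (Suc m) * v\<rceil>)" by linarith
  then show ?thesis by (simp add: grid_def field_simps)
qed

lemma grid_measurable [measurable]: "grid m \<in> borel_measurable borel"
  unfolding grid_def by measurable

lemma grid_LIMSEQ:
  assumes "0 \<le> v"
  shows "(\<lambda>m. grid m v) \<longlonglongrightarrow> v"
proof (rule tendsto_sandwich[where f="\<lambda>_. v" and h="\<lambda>m. v + 1 / real (Suc m)"])
  have "grid m v \<le> v + 1 / real (Suc m)" for m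
  proof -
    have "real (nat \<lceil>real (Suc m) * v\<rceil>) \<le> real (Suc m) * v + 1"
      using assms by (simp add: of_nat_nat) 
    then have "grid m v \<le> (real (Suc m) * v + 1) / real (Suc m)"
      unfolding grid_def by (rule divide_right_mono) simp
    also have "\<dots> = v + 1 / real (Suc m)"
      by (simp add: add_divide_distrib)
    finally show ?thesis .
  qed
  then show "\<forall>\<^sub>F m in sequentially. grid m v \<le> v + 1 / real (Suc m)" by simp
  have "(\<lambda>m. v + 1 / real (Suc m)) \<longlonglongrightarrow> v + 0"
    by (intro tendsto_intros LIMSEQ_Suc lim_1_over_n)
  then show "(\<lambda>m. v + 1 / real (Suc m)) \<longlonglongrightarrow> v" by simp
qed (auto simp: grid_ge)

text \<open>The rounded time takes countably many values, so sampling a process at it preserves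
  measurability from the fixed-time measurability alone. Rounding goes up so that the sampled times
  approach the true one from the right, where the paths are continuous.\<close>

lemma measurable_grid_compose:
  assumes f: "\<And>i. f (real i / real (Suc m)) \<in> borel_measurable N" and g[measurable]: "g \<in> borel_measurable N"
  shows "(\<lambda>x. f (grid m (g x)) x) \<in> borel_measurable N"
  unfolding grid_def
  by (rule measurable_compose_countable[where f="\<lambda>i x. f (real i / real (Suc m)) x"]) (use f in measurable)

section \<open>The subordinate process, its paths and a measurable modification\<close>

locale subordination =
  fixes M :: "'w measure" and B :: "real \<Rightarrow> 'w \<Rightarrow> 'a::euclidean_space" and S :: "real \<Rightarrow> 'w \<Rightarrow> real" and \<Psi> :: "real \<Rightarrow> real"
  assumes bm: "brownian_motion M B" and sub: "subordinator M \<Psi> S"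
    and indep: "prob_space.indep_set M (process_sets M B) (process_sets M S)"
begin

sublocale prob_space M
  using bm by (simp add: brownian_motion_def levy_process_def)

definition X :: "real \<Rightarrow> 'w \<Rightarrow> 'a" where "X t \<omega> = B (S t \<omega>) \<omega>"

lemma levy: "levy_process M B" "levy_process M S"
  using bm sub by (auto simp: brownian_motion_def subordinator_def)

lemma B_measurable [measurable]: "0 \<le> t \<Longrightarrow> B t \<in> borel_measurable M"
  and S_measurable [measurable]: "0 \<le> t \<Longrightarrow> S t \<in> borel_measurable M"
  using levy by (auto simp: levy_process_def)

text \<open>Bundles the almost sure path properties, so that limits can be taken for one \<omega> at
  a time. It is used through \<open>AE\<close> only.\<close>

definition good_path :: "'w \<Rightarrow> bool" where
  "good_path \<omega> \<longleftrightarrow> B 0 \<omega> = 0 \<and> S 0 \<omega> = 0 \<and> mono_on {0..} (\<lambda>t. S t \<omega>) \<and>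
    cadlag (\<lambda>t. S t \<omega>) \<and> continuous_on {0..} (\<lambda>t. B t \<omega>)"

lemma AE_good_path: "AE \<omega> in M. good_path \<omega>"
proof -
  have "AE \<omega> in M. B 0 \<omega> = 0" "AE \<omega> in M. S 0 \<omega> = 0" "AE \<omega> in M. cadlag (\<lambda>t. S t \<omega>)"
    using levy by (auto simp: levy_process_def)
  moreover have "AE \<omega> in M. mono_on {0..} (\<lambda>t. S t \<omega>)" "AE \<omega> in M. continuous_on {0..} (\<lambda>t. B t \<omega>)"
    using bm sub by (auto simp: brownian_motion_def subordinator_def)
  ultimately show ?thesis
    unfolding good_path_def by eventually_elim simp
qed

lemma good_path_S_mono: "good_path \<omega> \<Longrightarrow> 0 \<le> s \<Longrightarrow> s \<le> t \<Longrightarrow> S s \<omega> \<le> S t \<omega>"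
  unfolding good_path_def mono_on_def by auto

lemma good_path_S_nonneg: "good_path \<omega> \<Longrightarrow> 0 \<le> s \<Longrightarrow> 0 \<le> S s \<omega>"
  using good_path_S_mono[of \<omega> 0 s] by (simp add: good_path_def)

lemma good_path_B_LIMSEQ:
  assumes "good_path \<omega>" "(f \<longlongrightarrow> v) G" "0 \<le> v" "\<forall>\<^sub>F x in G. 0 \<le> f x"
  shows "((\<lambda>x. B (f x) \<omega>) \<longlongrightarrow> B v \<omega>) G"
proof (rule continuous_within_tendsto_compose[where S="{0..}"])
  show "continuous (at v within {0..}) (\<lambda>t. B t \<omega>)"
    using assms by (simp add: good_path_def continuous_on_eq_continuous_within)
qed (use assms in auto)

text \<open>A right-continuous time change followed by a continuous path. The nonnegativity of
  \<open>S\<close> near s is checked because \<open>B\<close> is continuous on [0,\<infinity>)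
  only.\<close>

lemma good_path_X_right_continuous:
  assumes "good_path \<omega>" "0 \<le> s"
  shows "continuous (at s within {s..}) (\<lambda>t. X t \<omega>)"
proof -
  have "((\<lambda>t. S t \<omega>) \<longlongrightarrow> S s \<omega>) (at_right s)"
    using assms by (auto simp: good_path_def cadlag_def)
  moreover have "\<forall>\<^sub>F t in at_right s. 0 \<le> S t \<omega>"
    unfolding eventually_at_filter using assms by (auto intro!: always_eventually good_path_S_nonneg)
  ultimately have "((\<lambda>t. X t \<omega>) \<longlongrightarrow> X s \<omega>) (at_right s)"
    unfolding X_def using assms by (intro good_path_B_LIMSEQ good_path_S_nonneg)
  then show ?thesis
    by (simp add: continuous_within at_within_Ici_at_right)
qed

text \<open>A jointly measurable modification: \<open>X\<close> itself need not even be measurable at fixed times,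
  because \<open>B\<close> is continuous only almost surely.\<close>

definition X_fixed :: "real \<Rightarrow> 'w \<Rightarrow> 'a" where
  "X_fixed s \<omega> = lim (\<lambda>m. B (grid m (S s \<omega>)) \<omega>)"

definition Z :: "real \<Rightarrow> 'w \<Rightarrow> 'a" where
  "Z s \<omega> = lim (\<lambda>j. X_fixed (grid j s) \<omega>)"

lemma X_fixed_measurable [measurable]: "0 \<le> s \<Longrightarrow> X_fixed s \<in> borel_measurable M"
  unfolding X_fixed_def
  by (rule borel_measurable_lim_metric, rule measurable_grid_compose[where f=B and g="S s"]) auto

text \<open>The inner limit copes with the random time \<open>S s\<close>, the outer one with the
  dependence on s. Since \<open>grid\<close> is never negative, only times at which \<open>S\<close>
  is known to be measurable occur, so no sign condition on s appears.\<close>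

lemma Z_measurable_pair [measurable]: "(\<lambda>x. Z (fst x) (snd x)) \<in> borel_measurable (borel \<Otimes>\<^sub>M M)"
  unfolding Z_def
proof (rule borel_measurable_lim_metric)
  fix j
  show "(\<lambda>x. X_fixed (grid j (fst x)) (snd x)) \<in> borel_measurable (borel \<Otimes>\<^sub>M M)"
  proof (rule measurable_grid_compose[where f="\<lambda>r x. X_fixed r (snd x)"])
    fix i
    show "(\<lambda>x. X_fixed (real i / real (Suc j)) (snd x)) \<in> borel_measurable (borel \<Otimes>\<^sub>M M)"
      by (rule measurable_compose[OF measurable_snd X_fixed_measurable]) simp
  qed simp
qed

lemma Z_measurable [measurable]: "Z s \<in> borel_measurable M"
proof -
  have "(\<lambda>\<omega>. Z (fst (s, \<omega>)) (snd (s, \<omega>))) \<in> borel_measurable M"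
    by (rule measurable_compose[OF _ Z_measurable_pair]) simp
  then show ?thesis by simp
qed

lemma good_path_X_fixed: "good_path \<omega> \<Longrightarrow> 0 \<le> s \<Longrightarrow> X_fixed s \<omega> = X s \<omega>"
  unfolding X_fixed_def X_def
  by (rule limI, rule good_path_B_LIMSEQ) (auto intro!: grid_LIMSEQ good_path_S_nonneg always_eventually grid_nonneg)

lemma good_path_Z:
  assumes "good_path \<omega>" "0 \<le> s"
  shows "Z s \<omega> = X s \<omega>"
proof -
  have "(\<lambda>j. X (grid j s) \<omega>) \<longlonglongrightarrow> X s \<omega>"
    by (rule continuous_within_tendsto_compose[OF good_path_X_right_continuous[OF assms]])
       (auto simp: grid_ge grid_LIMSEQ assms)
  then have "(\<lambda>j. X_fixed (grid j s) \<omega>) \<longlonglongrightarrow> X s \<omega>"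
    using assms by (simp add: good_path_X_fixed grid_nonneg)
  then show ?thesis
    unfolding Z_def by (rule limI)
qed

section \<open>Factorisation of the joint law of the two paths\<close>

definition pathB :: "'w \<Rightarrow> real \<Rightarrow> 'a" where "pathB \<omega> = (\<lambda>t\<in>{0..}. B t \<omega>)"
definition pathS :: "'w \<Rightarrow> real \<Rightarrow> real" where "pathS \<omega> = (\<lambda>t\<in>{0..}. S t \<omega>)"

lemma pathB_measurable [measurable]: "pathB \<in> M \<rightarrow>\<^sub>M PiM {0..} (\<lambda>_. borel)"
  unfolding pathB_def by (rule measurable_restrict) auto

lemma pathS_measurable [measurable]: "pathS \<in> M \<rightarrow>\<^sub>M PiM {0..} (\<lambda>_. borel)"
  unfolding pathS_def by (rule measurable_restrict) auto

text \<open>The generated sigma-algebras are the preimages under the two path maps, so their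
  independence is the product formula on rectangles. This is what permits Fubini over pairs of
  paths.\<close>

lemma distr_paths:
  "distr M (PiM {0..} (\<lambda>_. borel) \<Otimes>\<^sub>M PiM {0..} (\<lambda>_. borel)) (\<lambda>\<omega>. (pathB \<omega>, pathS \<omega>))
    = distr M (PiM {0..} (\<lambda>_. borel)) pathB \<Otimes>\<^sub>M distr M (PiM {0..} (\<lambda>_. borel)) pathS"
  (is "distr M (?P \<Otimes>\<^sub>M ?Q) ?f = ?PB \<Otimes>\<^sub>M ?PS")
proof (rule pair_measure_eqI[symmetric])
  show "sigma_finite_measure ?PB" "sigma_finite_measure ?PS"
    by (auto intro!: finite_measure.axioms(1) prob_space.finite_measure prob_space_distr)
  show "sets (?PB \<Otimes>\<^sub>M ?PS) = sets (distr M (?P \<Otimes>\<^sub>M ?Q) ?f)"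
    by (simp cong: sets_pair_measure_cong)
  fix A C assume "A \<in> sets ?PB" "C \<in> sets ?PS"
  then have A[measurable]: "A \<in> sets ?P" and C[measurable]: "C \<in> sets ?Q" by auto
  have "pathB -` A \<inter> space M \<in> process_sets M B" "pathS -` C \<inter> space M \<in> process_sets M S"
    unfolding process_sets_def pathB_def[abs_def, symmetric] pathS_def[abs_def, symmetric]
    using A C by (auto intro!: in_vimage_algebra)
  then have "prob ((pathB -` A \<inter> space M) \<inter> (pathS -` C \<inter> space M)) = prob (pathB -` A \<inter> space M) * prob (pathS -` C \<inter> space M)"
    by (rule indep_setD[OF indep])
  moreover have "(pathB -` A \<inter> space M) \<inter> (pathS -` C \<inter> space M) = ?f -` (A \<times> C) \<inter> space M" by auto
  ultimately show "emeasure ?PB A * emeasure ?PS C = emeasure (distr M (?P \<Otimes>\<^sub>M ?Q) ?f) (A \<times> C)"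
    by (simp add: emeasure_distr emeasure_eq_measure ennreal_mult)
qed

text \<open>The Brownian semigroup applied to \<open>F\<close> at the origin, as a function of time.
  The truncation \<open>max 0\<close> extends it to all reals, so that continuity and Borel
  measurability hold on the whole line.\<close>

definition avg :: "('a \<Rightarrow> complex) \<Rightarrow> real \<Rightarrow> complex" where
  "avg F v = (\<integral>\<omega>. F (B (max 0 v) \<omega>) \<partial>M)"

lemma avg_bound: "(\<And>x. norm (F x) \<le> 1) \<Longrightarrow> norm (avg F v) \<le> 1"
  unfolding avg_def by (rule norm_expectation_le) auto

lemma avg_continuous:
  assumes "continuous_on UNIV F" and "\<And>x. norm (F x) \<le> 1"
  shows "continuous_on UNIV (avg F)"
  unfolding continuous_on_sequentially
proof (intro allI ballI impI, elim conjE)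
  fix x :: "nat \<Rightarrow> real" and a :: real
  assume x: "x \<longlonglongrightarrow> a"
  have [measurable]: "F \<in> borel_measurable borel"
    using assms(1) by (rule borel_measurable_continuous_onI)
  show "(avg F \<circ> x) \<longlonglongrightarrow> avg F a"
    unfolding avg_def comp_def
  proof (rule integral_dominated_convergence[where w="\<lambda>_. 1"])
    show "AE \<omega> in M. (\<lambda>i. F (B (max 0 (x i)) \<omega>)) \<longlonglongrightarrow> F (B (max 0 a) \<omega>)"
      using AE_good_path
    proof eventually_elim
      case (elim \<omega>)
      have "(\<lambda>i. B (max 0 (x i)) \<omega>) \<longlonglongrightarrow> B (max 0 a) \<omega>"
        using elim by (rule good_path_B_LIMSEQ) (auto intro!: tendsto_intros x)
      then show ?case
        by (rule continuous_on_tendsto_compose[OF assms(1)]) auto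
    qed
  qed (auto simp: assms)
qed

lemma avg_measurable:
  assumes "continuous_on UNIV F" and "\<And>x. norm (F x) \<le> 1"
  shows "avg F \<in> borel_measurable borel"
  by (rule borel_measurable_continuous_onI[OF avg_continuous[OF assms]])

text \<open>On the product of the path spaces the path of \<open>S\<close> can be frozen, and the
  increments of \<open>B\<close> over the resulting deterministic times are independent. The
  rounding is essential: evaluating b at the time w(t) is not jointly measurable for the product
  sigma-algebra on uncountably many coordinates, whereas evaluation at a time from a countable set
  is.\<close>

lemma product_increments_grid:
  fixes F :: "nat \<Rightarrow> 'a \<Rightarrow> complex"
  assumes t: "mono t" "0 \<le> t 0"
    and cont: "\<And>k. continuous_on UNIV (F k)" and bnd: "\<And>k x. norm (F k x) \<le> 1"
  shows "(\<integral>\<omega>. (\<Prod>k<n. F k (B (grid m (S (t (Suc k)) \<omega>)) \<omega> - B (grid m (S (t k) \<omega>)) \<omega>)) \<partial>M)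
    = (\<integral>\<omega>. (\<Prod>k<n. avg (F k) (grid m (S (t (Suc k)) \<omega>) - grid m (S (t k) \<omega>))) \<partial>M)"
proof -
  have t0: "0 \<le> t k" for k
    using t monoD[OF t(1), of 0 k] by auto
  have F[measurable]: "F k \<in> borel_measurable borel" for k
    using cont by (rule borel_measurable_continuous_onI)
  have [measurable]: "avg (F k) \<in> borel_measurable borel" for k
    by (rule avg_measurable[OF cont bnd])
  have [measurable]: "S (t k) \<in> borel_measurable M" for k by (simp add: t0)
  let ?PB = "distr M (PiM {0..} (\<lambda>_. borel)) pathB" and ?PS = "distr M (PiM {0..} (\<lambda>_. borel)) pathS"
  interpret PB: prob_space ?PB by (rule prob_space_distr) simp
  interpret PS: prob_space ?PS by (rule prob_space_distr) simp
  interpret PPS: pair_sigma_finite ?PB ?PS ..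
  define G where "G b w = (\<Prod>k<n. F k (b (grid m (w (t (Suc k)))) - b (grid m (w (t k)))))" for b :: "real \<Rightarrow> 'a" and w :: "real \<Rightarrow> real"
  have comp: "(\<lambda>x. fst x (grid m (snd x (t k)))) \<in> borel_measurable (PiM {0..} (\<lambda>_. borel :: 'a measure) \<Otimes>\<^sub>M PiM {0..} (\<lambda>_. borel :: real measure))" for k
  proof (rule measurable_grid_compose[where f="\<lambda>r x. fst x r"])
    show "(\<lambda>x. fst x (real i / real (Suc m))) \<in> borel_measurable (PiM {0..} (\<lambda>_. borel :: 'a measure) \<Otimes>\<^sub>M PiM {0..} (\<lambda>_. borel :: real measure))" for i
      by (rule measurable_compose[OF measurable_fst measurable_component_singleton]) auto
    show "(\<lambda>x. snd x (t k)) \<in> borel_measurable (PiM {0..} (\<lambda>_. borel :: 'a measure) \<Otimes>\<^sub>M PiM {0..} (\<lambda>_. borel :: real measure))"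
      by (rule measurable_compose[OF measurable_snd measurable_component_singleton]) (auto simp: t0)
  qed
  have G[measurable]: "(\<lambda>x. G (fst x) (snd x)) \<in> borel_measurable (PiM {0..} (\<lambda>_. borel) \<Otimes>\<^sub>M PiM {0..} (\<lambda>_. borel))"
    unfolding G_def by (intro borel_measurable_prod measurable_compose[OF _ F] borel_measurable_diff comp)
  have Gb: "norm (G b w) \<le> 1" for b w
    unfolding G_def prod_norm[symmetric] by (rule prod_le_1) (auto simp: bnd)
  interpret PBS: prob_space "?PB \<Otimes>\<^sub>M ?PS" by (intro prob_space_pair PB.prob_space_axioms PS.prob_space_axioms)
  have sets: "sets (?PB \<Otimes>\<^sub>M ?PS) = sets (PiM {0..} (\<lambda>_. borel) \<Otimes>\<^sub>M PiM {0..} (\<lambda>_. borel))"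
    by (intro sets_pair_measure_cong) auto
  have intG: "integrable (?PB \<Otimes>\<^sub>M ?PS) (\<lambda>(b, w). G b w)"
  proof (rule PBS.integrable_const_bound[where B=1])
    show "(\<lambda>(b, w). G b w) \<in> borel_measurable (?PB \<Otimes>\<^sub>M ?PS)"
      using G by (simp add: measurable_cong_sets[OF sets refl] split_beta)
  qed (auto simp: Gb)
  have GM: "G (pathB \<omega>) (pathS \<omega>') = (\<Prod>k<n. F k (B (grid m (S (t (Suc k)) \<omega>')) \<omega> - B (grid m (S (t k) \<omega>')) \<omega>))" for \<omega> \<omega>'
    unfolding G_def pathB_def pathS_def by (simp add: t0 grid_nonneg)
  have "(\<integral>\<omega>. (\<Prod>k<n. F k (B (grid m (S (t (Suc k)) \<omega>)) \<omega> - B (grid m (S (t k) \<omega>)) \<omega>)) \<partial>M)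
      = (\<integral>\<omega>. G (pathB \<omega>) (pathS \<omega>) \<partial>M)"
    unfolding GM ..
  also have "\<dots> = (\<integral>x. G (fst x) (snd x) \<partial>distr M (PiM {0..} (\<lambda>_. borel) \<Otimes>\<^sub>M PiM {0..} (\<lambda>_. borel)) (\<lambda>\<omega>. (pathB \<omega>, pathS \<omega>)))"
    by (subst integral_distr[OF measurable_Pair[OF pathB_measurable pathS_measurable] G]) simp
  also have "\<dots> = (\<integral>x. (case x of (b, w) \<Rightarrow> G b w) \<partial>(?PB \<Otimes>\<^sub>M ?PS))"
    unfolding distr_paths by (simp add: split_beta)
  also have "\<dots> = (\<integral>w. \<integral>b. G b w \<partial>?PB \<partial>?PS)"
    by (rule PPS.integral_snd[OF intG, symmetric])
  also have "\<dots> = (\<integral>\<omega>'. \<integral>\<omega>. G (pathB \<omega>) (pathS \<omega>') \<partial>M \<partial>M)"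
  proof -
    have Gw: "(\<lambda>b. G b w) \<in> borel_measurable (PiM {0..} (\<lambda>_. borel))" if "w \<in> space (PiM {0..} (\<lambda>_. borel))" for w
      using measurable_compose[OF measurable_Pair2'[OF that] G] by simp
    have "(\<lambda>w. \<integral>b. G b w \<partial>?PB) \<in> borel_measurable (PiM {0..} (\<lambda>_. borel))"
    proof (rule PB.borel_measurable_lebesgue_integral)
      have "(\<lambda>x. G (fst (snd x, fst x)) (snd (snd x, fst x))) \<in> borel_measurable (PiM {0..} (\<lambda>_. borel) \<Otimes>\<^sub>M PiM {0..} (\<lambda>_. borel))"
        by (rule measurable_compose[OF _ G]) measurable
      moreover have "sets (PiM {0..} (\<lambda>_. borel) \<Otimes>\<^sub>M ?PB) = sets (PiM {0..} (\<lambda>_. borel) \<Otimes>\<^sub>M PiM {0..} (\<lambda>_. borel))"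
        by (intro sets_pair_measure_cong) auto
      ultimately show "(\<lambda>(w, b). G b w) \<in> borel_measurable (PiM {0..} (\<lambda>_. borel) \<Otimes>\<^sub>M ?PB)"
        unfolding split_beta fst_conv snd_conv by (subst measurable_cong_sets[OF _ refl])
    qed
    then have "(\<integral>w. \<integral>b. G b w \<partial>?PB \<partial>?PS) = (\<integral>\<omega>'. \<integral>b. G b (pathS \<omega>') \<partial>?PB \<partial>M)"
      by (rule integral_distr[OF pathS_measurable])
    also have "\<dots> = (\<integral>\<omega>'. \<integral>\<omega>. G (pathB \<omega>) (pathS \<omega>') \<partial>M \<partial>M)"
      by (rule Bochner_Integration.integral_cong[OF refl], rule integral_distr[OF pathB_measurable Gw])
         (rule measurable_space[OF pathS_measurable])
    finally show ?thesis .
  qed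
  also have "\<dots> = (\<integral>\<omega>'. (\<Prod>k<n. avg (F k) (grid m (S (t (Suc k)) \<omega>') - grid m (S (t k) \<omega>'))) \<partial>M)"
  proof (rule integral_cong_AE)
    show "AE \<omega>' in M. (\<integral>\<omega>. G (pathB \<omega>) (pathS \<omega>') \<partial>M) = (\<Prod>k<n. avg (F k) (grid m (S (t (Suc k)) \<omega>') - grid m (S (t k) \<omega>')))"
      using AE_good_path
    proof eventually_elim
      case (elim \<omega>')
      define u where "u k = grid m (S (t k) \<omega>')" for k
      have u: "mono u" "0 \<le> u 0"
        unfolding u_def using t t0 elim by (auto intro!: monoI grid_mono good_path_S_mono grid_nonneg simp: monoD)
      have "(\<integral>\<omega>. G (pathB \<omega>) (pathS \<omega>') \<partial>M) = (\<integral>\<omega>. (\<Prod>k<n. F k (B (u (Suc k)) \<omega> - B (u k) \<omega>)) \<partial>M)"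
        by (simp add: GM u_def)
      also have "\<dots> = (\<Prod>k<n. \<integral>\<omega>. F k (B (u (Suc k) - u k) \<omega>) \<partial>M)"
        by (rule levy_process_product_increments[OF levy(1) u F bnd])
      also have "\<dots> = (\<Prod>k<n. avg (F k) (u (Suc k) - u k))"
        unfolding avg_def using monoD[OF u(1), of k "Suc k" for k] by (intro prod.cong) (auto simp: max_absorb2)
      finally show ?case unfolding u_def .
    qed
    show "(\<lambda>\<omega>'. \<integral>\<omega>. G (pathB \<omega>) (pathS \<omega>') \<partial>M) \<in> borel_measurable M"
    proof (rule borel_measurable_lebesgue_integral)
      have "(\<lambda>x. G (fst (pathB (snd x), pathS (fst x))) (snd (pathB (snd x), pathS (fst x)))) \<in> borel_measurable (M \<Otimes>\<^sub>M M)"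
        by (rule measurable_compose[OF _ G]) measurable
      then show "(\<lambda>(\<omega>', \<omega>). G (pathB \<omega>) (pathS \<omega>')) \<in> borel_measurable (M \<Otimes>\<^sub>M M)"
        by (simp add: split_beta)
    qed
    show "(\<lambda>\<omega>'. \<Prod>k<n. avg (F k) (grid m (S (t (Suc k)) \<omega>') - grid m (S (t k) \<omega>'))) \<in> borel_measurable M"
      by measurable
  qed
  finally show ?thesis .
qed

text \<open>Both sides of the rounded identity converge as the mesh shrinks, everything being
  bounded by 1: the left by path continuity of \<open>B\<close>, the right by continuity of
  \<open>avg\<close>. Independence and stationarity of the increments of \<open>S\<close> then
  factor the limit.\<close>

lemma product_increments_subordinated:
  fixes F :: "nat \<Rightarrow> 'a \<Rightarrow> complex"
  assumes t: "mono t" "0 \<le> t 0"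
    and cont: "\<And>k. continuous_on UNIV (F k)" and bnd: "\<And>k x. norm (F k x) \<le> 1"
  shows "(\<integral>\<omega>. (\<Prod>k<n. F k (Z (t (Suc k)) \<omega> - Z (t k) \<omega>)) \<partial>M)
    = (\<Prod>k<n. \<integral>\<omega>. avg (F k) (S (t (Suc k) - t k) \<omega>) \<partial>M)"
proof -
  have F[measurable]: "F k \<in> borel_measurable borel" for k
    using cont by (rule borel_measurable_continuous_onI)
  have avgm[measurable]: "avg (F k) \<in> borel_measurable borel" for k
    by (rule avg_measurable[OF cont bnd])
  have t0: "0 \<le> t k" for k
    using t monoD[OF t(1), of 0 k] by auto
  have Sm[measurable]: "S (t k) \<in> borel_measurable M" for k by (simp add: t0)
  have 1: "(\<lambda>m. \<integral>\<omega>. (\<Prod>k<n. F k (B (grid m (S (t (Suc k)) \<omega>)) \<omega> - B (grid m (S (t k) \<omega>)) \<omega>)) \<partial>M)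
    \<longlonglongrightarrow> (\<integral>\<omega>. (\<Prod>k<n. F k (Z (t (Suc k)) \<omega> - Z (t k) \<omega>)) \<partial>M)"
  proof (rule integral_dominated_convergence[where w="\<lambda>_. 1"])
    show "AE \<omega> in M. (\<lambda>m. \<Prod>k<n. F k (B (grid m (S (t (Suc k)) \<omega>)) \<omega> - B (grid m (S (t k) \<omega>)) \<omega>))
        \<longlonglongrightarrow> (\<Prod>k<n. F k (Z (t (Suc k)) \<omega> - Z (t k) \<omega>))"
      using AE_good_path
    proof eventually_elim
      case (elim \<omega>)
      have *: "(\<lambda>m. B (grid m (S (t k) \<omega>)) \<omega>) \<longlonglongrightarrow> Z (t k) \<omega>" for k
        unfolding good_path_Z[OF elim t0] X_def
        by (rule good_path_B_LIMSEQ[OF elim])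
           (auto intro!: grid_LIMSEQ good_path_S_nonneg always_eventually grid_nonneg elim t0)
      show ?case
        by (intro tendsto_prod continuous_on_tendsto_compose[OF cont] tendsto_diff *) auto
    qed
    show "(\<lambda>\<omega>. \<Prod>k<n. F k (B (grid m (S (t (Suc k)) \<omega>)) \<omega> - B (grid m (S (t k) \<omega>)) \<omega>)) \<in> borel_measurable M" for m
      by (intro borel_measurable_prod measurable_compose[OF _ F] borel_measurable_diff
          measurable_grid_compose[where f=B and g="S (t _)"]) auto
    show "AE \<omega> in M. norm (\<Prod>k<n. F k (B (grid m (S (t (Suc k)) \<omega>)) \<omega> - B (grid m (S (t k) \<omega>)) \<omega>)) \<le> 1" for m
      by (auto simp: prod_norm[symmetric] intro!: prod_le_1 bnd)
  qed (auto intro!: borel_measurable_prod measurable_compose[OF _ F])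
  have 2: "(\<lambda>m. \<integral>\<omega>. (\<Prod>k<n. avg (F k) (grid m (S (t (Suc k)) \<omega>) - grid m (S (t k) \<omega>))) \<partial>M)
    \<longlonglongrightarrow> (\<integral>\<omega>. (\<Prod>k<n. avg (F k) (S (t (Suc k)) \<omega> - S (t k) \<omega>)) \<partial>M)"
  proof (rule integral_dominated_convergence[where w="\<lambda>_. 1"])
    show "AE \<omega> in M. (\<lambda>m. \<Prod>k<n. avg (F k) (grid m (S (t (Suc k)) \<omega>) - grid m (S (t k) \<omega>)))
        \<longlonglongrightarrow> (\<Prod>k<n. avg (F k) (S (t (Suc k)) \<omega> - S (t k) \<omega>))"
      using AE_good_path
    proof eventually_elim
      case (elim \<omega>)
      show ?case
        by (intro tendsto_prod continuous_on_tendsto_compose[OF avg_continuous[OF cont bnd]] tendsto_diff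
            grid_LIMSEQ good_path_S_nonneg elim t0) auto
    qed
    show "AE \<omega> in M. norm (\<Prod>k<n. avg (F k) (grid m (S (t (Suc k)) \<omega>) - grid m (S (t k) \<omega>))) \<le> 1" for m
      by (auto simp: prod_norm[symmetric] intro!: prod_le_1 avg_bound bnd)
    show "(\<lambda>\<omega>. \<Prod>k<n. avg (F k) (grid m (S (t (Suc k)) \<omega>) - grid m (S (t k) \<omega>))) \<in> borel_measurable M" for m
      by measurable
  qed (auto intro!: borel_measurable_prod measurable_compose[OF _ avgm])
  have "(\<integral>\<omega>. (\<Prod>k<n. F k (Z (t (Suc k)) \<omega> - Z (t k) \<omega>)) \<partial>M) = (\<integral>\<omega>. (\<Prod>k<n. avg (F k) (S (t (Suc k)) \<omega> - S (t k) \<omega>)) \<partial>M)"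
    using 1 2 unfolding product_increments_grid[OF t cont bnd] by (rule LIMSEQ_unique)
  also have "\<dots> = (\<Prod>k<n. \<integral>\<omega>. avg (F k) (S (t (Suc k) - t k) \<omega>) \<partial>M)"
    by (rule levy_process_product_increments[OF levy(2) t avgm]) (intro avg_bound bnd)
  finally show ?thesis .
qed

section \<open>Increments and characteristic function of the subordinate process\<close>

lemma Z_0: "AE \<omega> in M. Z 0 \<omega> = 0"
  using AE_good_path by eventually_elim (simp add: good_path_Z X_def, simp add: good_path_def)

lemma expectation_Z:
  fixes F :: "'a \<Rightarrow> complex"
  assumes "0 \<le> t" and cont: "continuous_on UNIV F" and bnd: "\<And>x. norm (F x) \<le> 1"
  shows "(\<integral>\<omega>. F (Z t \<omega>) \<partial>M) = (\<integral>\<omega>. avg F (S t \<omega>) \<partial>M)"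
proof -
  have F[measurable]: "F \<in> borel_measurable borel"
    using cont by (rule borel_measurable_continuous_onI)
  have "(\<integral>\<omega>. F (Z t \<omega>) \<partial>M) = (\<integral>\<omega>. F (Z t \<omega> - Z 0 \<omega>) \<partial>M)"
    using Z_0 by (intro integral_cong_AE) auto
  \<comment> \<open>The product formula with a single factor, along the times 0, t, t, and so
    on.\<close>
  also have "\<dots> = (\<integral>\<omega>. avg F (S t \<omega>) \<partial>M)"
    using product_increments_subordinated[of "\<lambda>k. if k = 0 then 0 else t" "\<lambda>_. F" 1] assms
    by (simp add: mono_def)
  finally show ?thesis .
qed

text \<open>Independent stationary increments of \<open>Z\<close>, tested on bounded continuous
  functions; the Gaussian test functions of the survival estimate are of this kind.\<close>

lemma Z_product_increments:
  fixes F :: "nat \<Rightarrow> 'a \<Rightarrow> complex"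
  assumes t: "mono t" "0 \<le> t 0"
    and cont: "\<And>k. continuous_on UNIV (F k)" and bnd: "\<And>k x. norm (F k x) \<le> 1"
  shows "(\<integral>\<omega>. (\<Prod>k<n. F k (Z (t (Suc k)) \<omega> - Z (t k) \<omega>)) \<partial>M)
    = (\<Prod>k<n. \<integral>\<omega>. F k (Z (t (Suc k) - t k) \<omega>) \<partial>M)"
  unfolding product_increments_subordinated[OF t cont bnd]
  using monoD[OF t(1), of k "Suc k" for k]
  by (intro prod.cong refl expectation_Z[symmetric] cont bnd) simp

text \<open>Averaging first over \<open>B\<close> gives exp(-|\<xi>|^2 v) at time v, and averaging
  this over v = S_t is the Laplace transform of \<open>S\<close> at |\<xi>|^2. That transform is
  prescribed for positive arguments only, hence \<open>\<xi> \<noteq> 0\<close>.\<close>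

lemma Z_char:
  assumes "0 \<le> t" "\<xi> \<noteq> 0"
  shows "(\<integral>\<omega>. iexp (\<xi> \<bullet> Z t \<omega>) \<partial>M) = complex_of_real (exp (- t * \<Psi> ((norm \<xi>)\<^sup>2)))"
proof -
  have avg: "avg (\<lambda>x. iexp (\<xi> \<bullet> x)) v = complex_of_real (exp (- (norm \<xi>)\<^sup>2 * v))" if "0 \<le> v" for v
    using bm that unfolding brownian_motion_def avg_def by (simp add: max_absorb2 mult.commute)
  have Sm[measurable]: "S t \<in> borel_measurable M" using assms by simp
  have cont: "continuous_on UNIV (\<lambda>x. iexp (\<xi> \<bullet> x))" by (intro continuous_intros)
  have [measurable]: "avg (\<lambda>x. iexp (\<xi> \<bullet> x)) \<in> borel_measurable borel"
    by (rule avg_measurable[OF cont]) simp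
  have "(\<integral>\<omega>. iexp (\<xi> \<bullet> Z t \<omega>) \<partial>M) = (\<integral>\<omega>. avg (\<lambda>x. iexp (\<xi> \<bullet> x)) (S t \<omega>) \<partial>M)"
    by (rule expectation_Z[OF \<open>0 \<le> t\<close> cont]) simp
  also have "\<dots> = (\<integral>\<omega>. complex_of_real (exp (- (norm \<xi>)\<^sup>2 * S t \<omega>)) \<partial>M)"
  proof (rule integral_cong_AE)
    show "AE \<omega> in M. avg (\<lambda>x. iexp (\<xi> \<bullet> x)) (S t \<omega>) = complex_of_real (exp (- (norm \<xi>)\<^sup>2 * S t \<omega>))"
      using AE_good_path by eventually_elim (simp add: avg good_path_S_nonneg assms)
  qed measurable
  also have "\<dots> = complex_of_real (exp (- t * \<Psi> ((norm \<xi>)\<^sup>2)))"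
    using sub assms unfolding subordinator_def by simp
  finally show ?thesis .
qed

end

section \<open>Density and survival estimates\<close>

text \<open>The Gaussian is its own Fourier transform, so Fubini turns the left-hand side into a Gaussian
  average of the characteristic function of \<open>Z t\<close>.\<close>

lemma (in subordination) expectation_exp_square_le:
  fixes e :: 'a
  assumes \<Psi>: "bernstein0 \<Psi>" "strict_mono_on {0<..} \<Psi>" and e: "norm e = 1" and "R > 0" "0 \<le> t"
  shows "(\<integral>\<omega>. exp (- ((e \<bullet> Z t \<omega>) / R)\<^sup>2 / 2) \<partial>M)
    \<le> (\<integral>w. std_normal_density w * exp (- (t * \<Psi> (R powr - 2)) * (min (w\<^sup>2) 1 / 2)) \<partial>lborel)"
proof -
  interpret pair_sigma_finite M "lborel :: real measure" ..
  let ?g = "\<lambda>\<omega> w. complex_of_real (std_normal_density w) * iexp ((e \<bullet> Z t \<omega>) / R * w)"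
  let ?h = "\<lambda>w. complex_of_real (std_normal_density w) * (\<integral>\<omega>. iexp ((w / R) *\<^sub>R e \<bullet> Z t \<omega>) \<partial>M)"
  let ?b = "\<lambda>w. std_normal_density w * exp (- (t * \<Psi> (R powr - 2)) * (min (w\<^sup>2) 1 / 2))"
  have isd: "integrable lborel std_normal_density"
    using integrable_std_normal_moment[of 0] by simp
  have nnsd: "(\<integral>\<^sup>+w. ennreal (std_normal_density w) \<partial>lborel) = 1"
    using prob_space.emeasure_space_1[OF prob_space_normal_density[of 1 0]]
    by (simp add: emeasure_density)
  have ch: "(\<integral>w. complex_of_real (std_normal_density w) * iexp (z * w) \<partial>lborel) = complex_of_real (exp (- z\<^sup>2 / 2))" for z :: real
    using gauss_char[of z] by (simp add: gauss_def)
  have R2: "0 < R powr - 2" using \<open>R > 0\<close> by simp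
  have nonneg: "0 \<le> \<Psi> (R powr - 2)"
    using \<Psi>(1) R2 by (simp add: bernstein0_def)
  have intg: "integrable (M \<Otimes>\<^sub>M lborel) (\<lambda>(\<omega>, w). ?g \<omega> w)"
  proof (rule Fubini_integrable)
    show "AE \<omega> in M. integrable lborel (\<lambda>w. case (\<omega>, w) of (\<omega>, w) \<Rightarrow> ?g \<omega> w)"
      by (intro AE_I2 Bochner_Integration.integrable_bound[OF isd]) (auto simp: norm_mult)
  qed (auto simp: norm_mult nnsd)
  have "complex_of_real (\<integral>\<omega>. exp (- ((e \<bullet> Z t \<omega>) / R)\<^sup>2 / 2) \<partial>M) = (\<integral>\<omega>. \<integral>w. ?g \<omega> w \<partial>lborel \<partial>M)"
    by (simp only: ch integral_complex_of_real)
  also have "\<dots> = (\<integral>w. \<integral>\<omega>. ?g \<omega> w \<partial>M \<partial>lborel)"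
    by (rule Fubini_integral[OF intg, symmetric])
  also have "\<dots> = integral\<^sup>L lborel ?h"
    by (intro Bochner_Integration.integral_cong refl, subst integral_mult_right_zero[symmetric])
       (simp add: mult_ac)
  finally have eq: "complex_of_real (\<integral>\<omega>. exp (- ((e \<bullet> Z t \<omega>) / R)\<^sup>2 / 2) \<partial>M) = integral\<^sup>L lborel ?h" .
  \<comment> \<open>The frequency is (w/R) e, of squared length w^2 R^-2. Monotonicity handles |w|
    \<ge> 1 and \<open>bernstein0_scaling\<close> with a = min(w^2, 1) handles small w. The excluded
    value w = 0 is a null set.\<close>
  have hb: "norm (?h w) \<le> ?b w" if "w \<noteq> 0" for w
  proof -
    have e0: "(w / R) *\<^sub>R e \<noteq> 0" using that \<open>R > 0\<close> e by auto
    have nrm: "(norm ((w / R) *\<^sub>R e))\<^sup>2 = w\<^sup>2 * R powr - 2"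
      using e \<open>R > 0\<close> by (simp add: power_mult_distrib power_inverse powr_minus divide_inverse)
    have "min (w\<^sup>2) 1 / 2 * \<Psi> (R powr - 2) \<le> \<Psi> (min (w\<^sup>2) 1 * R powr - 2)"
      using that R2 by (intro bernstein0_scaling \<Psi>) auto
    also have "\<dots> \<le> \<Psi> (w\<^sup>2 * R powr - 2)"
      using \<Psi>(2) R2 that by (intro mono_onD[OF strict_mono_on_imp_mono_on[OF \<Psi>(2)]]) (auto simp: min_def)
    finally have "t * (min (w\<^sup>2) 1 / 2 * \<Psi> (R powr - 2)) \<le> t * \<Psi> (w\<^sup>2 * R powr - 2)"
      using \<open>0 \<le> t\<close> by (rule mult_left_mono)
    then have "exp (- t * \<Psi> (w\<^sup>2 * R powr - 2)) \<le> exp (- (t * \<Psi> (R powr - 2)) * (min (w\<^sup>2) 1 / 2))"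
      by (simp add: mult_ac)
    then have "std_normal_density w * exp (- t * \<Psi> (w\<^sup>2 * R powr - 2)) \<le> ?b w"
      by (rule mult_left_mono) simp
    moreover have "norm (?h w) = std_normal_density w * exp (- t * \<Psi> (w\<^sup>2 * R powr - 2))"
      unfolding Z_char[OF \<open>0 \<le> t\<close> e0] nrm norm_mult norm_of_real by simp
    ultimately show ?thesis by simp
  qed
  have intb: "integrable lborel ?b"
  proof (rule Bochner_Integration.integrable_bound[OF isd])
    show "AE w in lborel. norm (?b w) \<le> norm (std_normal_density w)"
      using nonneg \<open>0 \<le> t\<close> by (intro AE_I2) (auto simp: norm_mult intro!: mult_left_le)
  qed measurable
  have inth: "integrable lborel ?h"
  proof (rule Bochner_Integration.integrable_bound[OF intb])
    show "AE w in lborel. norm (?h w) \<le> norm (?b w)"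
      using AE_lborel_singleton[of "0::real"] by eventually_elim (use hb in fastforce)
  qed measurable
  have "(\<integral>\<omega>. exp (- ((e \<bullet> Z t \<omega>) / R)\<^sup>2 / 2) \<partial>M) = norm (integral\<^sup>L lborel ?h)"
    unfolding eq[symmetric] norm_of_real by (subst abs_of_nonneg) (auto intro!: integral_nonneg_AE)
  also have "\<dots> \<le> (\<integral>w. norm (?h w) \<partial>lborel)"
    by (rule integral_norm_bound)
  also have "\<dots> \<le> integral\<^sup>L lborel ?b"
  proof (rule integral_mono_AE)
    show "AE w in lborel. norm (?h w) \<le> ?b w"
      using AE_lborel_singleton[of "0::real"] by eventually_elim (use hb in fastforce)
  qed (use inth intb in auto)
  finally show ?thesis .
qed

text \<open>An exponential Chebyshev bound: on the event each factor exp(1/2) \<open>?q\<close> is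
  at least 1, so the probability is at most the expectation of the product, which factors by
  independence into n terms of size at most 1/2. Projecting on one direction \<open>e\<close> keeps
  the one-step bound independent of the dimension.\<close>

lemma (in subordination) prob_small_increments:
  fixes e :: 'a
  assumes \<Psi>: "bernstein0 \<Psi>" "strict_mono_on {0<..} \<Psi>" and "norm e = 1" "R > 0" "0 \<le> t"
    and small: "exp (1 / 2) * (\<integral>w. std_normal_density w * exp (- (t * \<Psi> (R powr - 2)) * (min (w\<^sup>2) 1 / 2)) \<partial>lborel) \<le> 1 / 2"
  shows "prob {\<omega>\<in>space M. \<forall>k<n. \<bar>e \<bullet> (Z (real (Suc k) * t) \<omega> - Z (real k * t) \<omega>)\<bar> \<le> R} \<le> (1 / 2) ^ n"
proof -
  let ?q = "\<lambda>x::'a. exp (- ((e \<bullet> x) / R)\<^sup>2 / 2)"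
  let ?\<Delta> = "\<lambda>k \<omega>. Z (real (Suc k) * t) \<omega> - Z (real k * t) \<omega>"
  let ?A = "{\<omega>\<in>space M. \<forall>k<n. \<bar>e \<bullet> ?\<Delta> k \<omega>\<bar> \<le> R}"
  have q1: "?q x \<le> 1" for x by simp
  have "prob ?A = (\<integral>\<omega>. indicator ?A \<omega> \<partial>M)" by simp
  also have "\<dots> \<le> (\<integral>\<omega>. exp (1 / 2) ^ n * (\<Prod>k<n. ?q (?\<Delta> k \<omega>)) \<partial>M)"
  proof (rule integral_mono)
    have "integrable M (\<lambda>\<omega>. \<Prod>k<n. ?q (?\<Delta> k \<omega>))"
      by (rule integrable_const_bound[where B=1]) (auto simp: abs_prod intro!: prod_le_1)
    then show "integrable M (\<lambda>\<omega>. exp (1 / 2) ^ n * (\<Prod>k<n. ?q (?\<Delta> k \<omega>)))" by simp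
    fix \<omega>
    show "indicator ?A \<omega> \<le> exp (1 / 2) ^ n * (\<Prod>k<n. ?q (?\<Delta> k \<omega>))"
    proof (cases "\<omega> \<in> ?A")
      case True
      have "1 \<le> (\<Prod>k<n. exp (1 / 2) * ?q (?\<Delta> k \<omega>))"
      proof (rule prod_ge_1)
        fix k assume "k \<in> {..<n}"
        then have "\<bar>e \<bullet> ?\<Delta> k \<omega>\<bar> \<le> R" using True by auto
        then have "\<bar>(e \<bullet> ?\<Delta> k \<omega>) / R\<bar> \<le> 1" using \<open>R > 0\<close> by simp
        then have "((e \<bullet> ?\<Delta> k \<omega>) / R)\<^sup>2 \<le> 1" by (simp only: abs_square_le_1)
        then show "1 \<le> exp (1 / 2) * ?q (?\<Delta> k \<omega>)" by (simp add: exp_add[symmetric])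
      qed
      then show ?thesis using True by (simp add: prod.distrib)
    next
      case False
      then show ?thesis by (simp add: prod_nonneg)
    qed
  qed (auto intro!: integrable_real_indicator simp: emeasure_eq_measure simp del: of_nat_Suc)
  also have "\<dots> = exp (1 / 2) ^ n * (\<integral>\<omega>. (\<Prod>k<n. ?q (?\<Delta> k \<omega>)) \<partial>M)" by simp
  also have "(\<integral>\<omega>. (\<Prod>k<n. ?q (?\<Delta> k \<omega>)) \<partial>M) = (\<Prod>k<n. \<integral>\<omega>. ?q (Z t \<omega>) \<partial>M)"
  proof -
    \<comment> \<open>The increment formula is stated for complex-valued functions, so the real
      product is embedded and recovered afterwards.\<close>
    have "complex_of_real (\<integral>\<omega>. (\<Prod>k<n. ?q (?\<Delta> k \<omega>)) \<partial>M) = (\<integral>\<omega>. (\<Prod>k<n. complex_of_real (?q (?\<Delta> k \<omega>))) \<partial>M)"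
      by (simp only: integral_complex_of_real[symmetric] of_real_prod)
    also have "\<dots> = (\<Prod>k<n. \<integral>\<omega>. complex_of_real (?q (Z (real (Suc k) * t - real k * t) \<omega>)) \<partial>M)"
    proof (rule Z_product_increments[where t="\<lambda>k. real k * t" and F="\<lambda>_ x. complex_of_real (?q x)"])
      show "mono (\<lambda>k. real k * t)" using \<open>0 \<le> t\<close> by (intro monoI mult_right_mono) auto
      show "continuous_on UNIV (\<lambda>x. complex_of_real (?q x))" using \<open>R > 0\<close> by (intro continuous_intros) auto
    qed auto
    also have "\<dots> = complex_of_real (\<Prod>k<n. \<integral>\<omega>. ?q (Z t \<omega>) \<partial>M)"
      by (simp only: integral_complex_of_real of_real_prod) (simp add: algebra_simps)
    finally show ?thesis by (simp only: of_real_eq_iff)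
  qed
  also have "exp (1 / 2) ^ n * (\<Prod>k<n. \<integral>\<omega>. ?q (Z t \<omega>) \<partial>M) = (exp (1 / 2) * (\<integral>\<omega>. ?q (Z t \<omega>) \<partial>M)) ^ n"
    by (simp add: power_mult_distrib)
  also have "\<dots> \<le> (1 / 2) ^ n"
  proof (rule power_mono)
    have "exp (1 / 2) * (\<integral>\<omega>. ?q (Z t \<omega>) \<partial>M) \<le> exp (1 / 2) * (\<integral>w. std_normal_density w * exp (- (t * \<Psi> (R powr - 2)) * (min (w\<^sup>2) 1 / 2)) \<partial>lborel)"
      by (intro mult_left_mono expectation_exp_square_le assms) simp
    from this small show "exp (1 / 2) * (\<integral>\<omega>. ?q (Z t \<omega>) \<partial>M) \<le> 1 / 2" by (rule order_trans)
    show "0 \<le> exp (1 / 2) * (\<integral>\<omega>. ?q (Z t \<omega>) \<partial>M)" by (simp add: integral_nonneg_AE)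
  qed
  finally show ?thesis .
qed

text \<open>Testing membership in \<open>D\<close> only at the multiples of \<open>h\<close> keeps the event measurable; it contains
  the event that the exit time is at least \<open>s\<close>.\<close>

definition (in subordination) survives :: "'a set \<Rightarrow> 'a \<Rightarrow> real \<Rightarrow> real \<Rightarrow> 'w \<Rightarrow> bool" where
  "survives D x h s \<omega> \<longleftrightarrow> (\<forall>k::nat. 0 < k \<and> real k * h < s \<longrightarrow> x + Z (real k * h) \<omega> \<in> D)"

text \<open>Consecutive sampled positions in \<open>D\<close> differ by at most the diameter, also
  from time 0 because x is in \<open>D\<close> and \<open>Z\<close> starts at 0 almost surely. This
  gives 2^(-n) with n at least s/h - 1; the prefactor 2 pays for the rounding.\<close>

lemma (in subordination) emeasure_survives_le:
  assumes \<Psi>: "bernstein0 \<Psi>" "strict_mono_on {0<..} \<Psi>" and D: "bounded D" "x \<in> D" "D \<in> sets borel" and h: "h > 0" and R: "diameter D > 0"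
    and small: "exp (1 / 2) * (\<integral>w. std_normal_density w * exp (- (h * \<Psi> (diameter D powr - 2)) * (min (w\<^sup>2) 1 / 2)) \<partial>lborel) \<le> 1 / 2"
    and "s > 0"
  shows "emeasure M {\<omega>\<in>space M. survives D x h s \<omega>} \<le> ennreal (2 * exp (- (ln 2 / h) * s))"
proof -
  obtain e :: 'a where e: "e \<in> Basis" using nonempty_Basis by blast
  \<comment> \<open>The largest n with n h < s. The inequality is strict, since
    \<open>survives\<close> constrains only the times strictly before s; hence the ceiling minus
    one.\<close>
  define n where "n = nat (\<lceil>s / h\<rceil> - 1)"
  have pos: "0 < s / h" using h \<open>s > 0\<close> by simp
  then have ceil: "1 \<le> \<lceil>s / h\<rceil>" by (simp add: one_le_ceiling)
  then have n: "real n = of_int \<lceil>s / h\<rceil> - 1" unfolding n_def by simp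
  let ?A = "{\<omega>\<in>space M. \<forall>k<n. \<bar>e \<bullet> (Z (real (Suc k) * h) \<omega> - Z (real k * h) \<omega>)\<bar> \<le> diameter D}"
  have [measurable]: "D \<in> sets borel" by fact
  have "emeasure M {\<omega>\<in>space M. survives D x h s \<omega>} \<le> emeasure M ?A"
  proof (rule emeasure_mono_AE)
    show "AE \<omega> in M. \<omega> \<in> {\<omega>\<in>space M. survives D x h s \<omega>} \<longrightarrow> \<omega> \<in> ?A"
      using Z_0
    proof eventually_elim
      case (elim \<omega>)
      show ?case
      proof safe
        fix k assume sv: "survives D x h s \<omega>" and k: "k < n"
        have "real n < s / h" using n by linarith
        then have nh: "real n * h < s" using h by (simp add: field_simps)
        have inD: "x + Z (real j * h) \<omega> \<in> D" if "j \<le> n" for j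
        proof (cases "j = 0")
          case True
          then show ?thesis using elim D by simp
        next
          case False
          have "real j * h \<le> real n * h" using that h by (intro mult_right_mono) auto
          with nh have "real j * h < s" by linarith
          then show ?thesis using sv False unfolding survives_def by auto
        qed
        have "\<bar>e \<bullet> (Z (real (Suc k) * h) \<omega> - Z (real k * h) \<omega>)\<bar> \<le> norm (Z (real (Suc k) * h) \<omega> - Z (real k * h) \<omega>)"
          using Cauchy_Schwarz_ineq2[of e "Z (real (Suc k) * h) \<omega> - Z (real k * h) \<omega>"] e by simp
        also have "\<dots> = norm ((x + Z (real (Suc k) * h) \<omega>) - (x + Z (real k * h) \<omega>))"
          by simp
        also have "\<dots> \<le> diameter D"
          using diameter_bounded_bound[OF D(1) inD inD, of "Suc k" k] k by (simp add: dist_norm)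
        finally show "\<bar>e \<bullet> (Z (real (Suc k) * h) \<omega> - Z (real k * h) \<omega>)\<bar> \<le> diameter D" .
      qed
    qed
  qed measurable
  also have "\<dots> \<le> ennreal ((1 / 2) ^ n)"
    unfolding emeasure_eq_measure using h e R small
    by (intro ennreal_leI prob_small_increments \<Psi>) auto
  also have "\<dots> \<le> ennreal (2 * exp (- (ln 2 / h) * s))"
  proof (rule ennreal_leI)
    have "(1 / 2 :: real) ^ n = (1 / 2) powr real n" by (simp add: powr_realpow)
    also have "\<dots> = exp (- real n * ln 2)" by (simp add: powr_def ln_div)
    also have "\<dots> \<le> exp (ln 2 - (ln 2 / h) * s)"
    proof -
      have "s / h - 1 \<le> real n" using n by linarith
      then have "(s / h - 1) * ln 2 \<le> real n * ln 2" by (intro mult_right_mono) auto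
      then show ?thesis by (simp add: algebra_simps)
    qed
    also have "\<dots> = 2 * exp (- (ln 2 / h) * s)" by (simp add: exp_diff exp_minus field_simps)
    finally show "(1 / 2) ^ n \<le> 2 * exp (- (ln 2 / h) * s)" .
  qed
  finally show ?thesis .
qed

text \<open>Translation by \<open>x\<close> multiplies the characteristic function by a unimodular
  factor, so the density bound is uniform in the starting point. Comparing the law with a multiple
  of Lebesgue measure lifts the bound from sets to functions.\<close>

lemma (in subordination) nn_integral_Z_le:
  fixes f :: "'a \<Rightarrow> ennreal"
  assumes f: "f \<in> borel_measurable borel" and "0 \<le> s" and \<psi>: "\<psi> \<in> borel_measurable borel"
    "\<And>\<xi>::'a. \<xi> \<noteq> 0 \<Longrightarrow> ennreal (exp (- s * \<Psi> ((norm \<xi>)\<^sup>2))) \<le> \<psi> \<xi>"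
    and K: "(\<integral>\<^sup>+\<xi>. \<psi> \<xi> \<partial>lborel) \<le> ennreal K"
  shows "(\<integral>\<^sup>+\<omega>. f (x + Z s \<omega>) \<partial>M) \<le> ennreal K * (\<integral>\<^sup>+y. f y \<partial>lborel)"
proof -
  let ?Y = "\<lambda>\<omega>. x + Z s \<omega>"
  have "AE \<xi> in lborel. ennreal (norm (\<integral>\<omega>. iexp (\<xi> \<bullet> ?Y \<omega>) \<partial>M)) \<le> \<psi> \<xi>"
    using AE_lborel_singleton[of "0::'a"]
  proof eventually_elim
    case (elim \<xi>)
    have "(\<integral>\<omega>. iexp (\<xi> \<bullet> ?Y \<omega>) \<partial>M) = iexp (\<xi> \<bullet> x) * (\<integral>\<omega>. iexp (\<xi> \<bullet> Z s \<omega>) \<partial>M)"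
      by (subst integral_mult_right_zero[symmetric]) (simp add: inner_add_right exp_add ring_distribs)
    then have "norm (\<integral>\<omega>. iexp (\<xi> \<bullet> ?Y \<omega>) \<partial>M) = exp (- s * \<Psi> ((norm \<xi>)\<^sup>2))"
      unfolding Z_char[OF \<open>0 \<le> s\<close> elim] by (simp add: norm_mult)
    then show ?case using \<psi>(2)[OF elim] by simp
  qed
  then have dom: "emeasure (distr M borel ?Y) A \<le> (\<integral>\<^sup>+\<xi>. \<psi> \<xi> \<partial>lborel) * emeasure lborel A" if "A \<in> sets borel" for A
    using K that \<psi> by (intro emeasure_le_char_integral prob_space_axioms) (auto intro: le_less_trans)
  have "(\<integral>\<^sup>+\<omega>. f (x + Z s \<omega>) \<partial>M) = (\<integral>\<^sup>+y. f y \<partial>distr M borel ?Y)"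
    using f by (subst nn_integral_distr) auto
  also have "\<dots> \<le> (\<integral>\<^sup>+y. f y \<partial>density lborel (\<lambda>_. ennreal K))"
  proof (rule nn_integral_mono_measure)
    show "distr M borel ?Y \<le> density lborel (\<lambda>_. ennreal K)"
    proof (rule le_measure[THEN iffD2], simp, intro ballI)
      fix A assume "A \<in> sets (distr M borel ?Y)"
      then have A: "A \<in> sets borel" by simp
      have "emeasure (distr M borel ?Y) A \<le> ennreal K * emeasure lborel A"
        using dom[OF A] mult_right_mono[OF K] by (rule order_trans) auto
      then show "emeasure (distr M borel ?Y) A \<le> emeasure (density lborel (\<lambda>_. ennreal K)) A"
        using A by (simp add: emeasure_density nn_integral_cmult)
    qed
  qed simp
  also have "\<dots> = ennreal K * (\<integral>\<^sup>+y. f y \<partial>lborel)"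
    using f by (simp add: nn_integral_density nn_integral_cmult)
  finally show ?thesis .
qed

section \<open>Occupation integrals and exit times\<close>

lemma conjugate_exponent_gt_1:
  fixes p p' :: real
  assumes "p > 1" and "1 / p + 1 / p' = 1"
  shows "p' > 1"
proof -
  have "1 / p' = 1 - 1 / p" using assms by simp
  then have "p' = 1 / (1 - 1 / p)" by (metis divide_divide_eq_right div_by_1 mult_1)
  moreover have "0 < 1 - 1 / p" "1 - 1 / p < 1" using assms by auto
  then have "1 < 1 / (1 - 1 / p)" by (simp only: less_divide_eq_1_pos)
  ultimately show ?thesis by simp
qed

lemma diameter_pos:
  fixes D :: "'a::euclidean_space set"
  assumes "open D" "bounded D" "D \<noteq> {}"
  shows "0 < diameter D"
proof -
  obtain x e where e: "e > 0" "cball x e \<subseteq> D"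
    using assms by (metis all_not_in_conv open_contains_cball)
  obtain b :: 'a where b: "b \<in> Basis" using nonempty_Basis by blast
  have "x + e *\<^sub>R b \<in> cball x e" using e b by (simp add: dist_norm)
  then have "dist (x + e *\<^sub>R b) x \<le> diameter D"
    using e by (intro diameter_bounded_bound[OF \<open>bounded D\<close>]) auto
  then show ?thesis using e b by (simp add: dist_norm)
qed

text \<open>Young's inequality for the factorisation F = (l F K^(-1/p)) (l^(-1) K^(1/p)), with p'/p
  = p' - 1. The free parameter \<open>l\<close> is what is optimised later: the two coefficients are
  l^p/p and l^(-p')/p'.\<close>

lemma weighted_Young:
  fixes p p' F K l :: real
  assumes "p > 1" and "1 / p + 1 / p' = 1" "0 \<le> F" "0 < K" "0 < l"
  shows "F \<le> l powr p / p * (F powr p / K) + l powr - p' / p' * K powr (p' - 1)"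
proof -
  have p': "1 / p' = 1 - 1 / p" using assms by simp
  have p'1: "p' > 1" using assms(1,2) by (rule conjugate_exponent_gt_1)
  have e: "p' / p = p' - 1" using p' p'1 assms by (simp add: field_simps)
  have "F = (l * F * K powr - (1 / p)) * (l powr - 1 * K powr (1 / p))"
    using assms by (simp add: powr_minus field_simps)
  also have "\<dots> \<le> (l * F * K powr - (1 / p)) powr p / p + (l powr - 1 * K powr (1 / p)) powr p' / p'"
    using assms p'1 by (intro Youngs_inequality) auto
  also have "(l * F * K powr - (1 / p)) powr p = l powr p * (F powr p / K)"
  proof -
    have "- (1 / p) * p = - 1" using assms by simp
    then have "(K powr - (1 / p)) powr p = K powr - 1" by (simp only: powr_powr)
    also have "\<dots> = 1 / K" using assms by (simp add: powr_minus_divide)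
    finally show ?thesis by (simp only: powr_mult) simp
  qed
  also have "(l powr - 1 * K powr (1 / p)) powr p' = l powr - p' * K powr (p' - 1)"
  proof -
    have "1 / p * p' = p' - 1" "- 1 * p' = - p'" using e by auto
    then show ?thesis by (simp only: powr_mult powr_powr)
  qed
  finally show ?thesis by (simp add: mult_ac)
qed

text \<open>A Lebesgue measurable function composed with the process need not be measurable; replacing it by
  a Borel majorant, infinite on a null set, avoids this.\<close>

lemma borel_majorant:
  fixes f :: "'b::euclidean_space \<Rightarrow> ennreal"
  assumes f: "f \<in> borel_measurable (lebesgue_on Q)" and Q: "Q \<in> sets borel"
  obtains \<Phi> where "\<Phi> \<in> borel_measurable borel" "\<And>z. z \<in> Q \<Longrightarrow> f z \<le> \<Phi> z"
    "(\<integral>\<^sup>+z. \<Phi> z \<partial>lborel) = (\<integral>\<^sup>+z. f z \<partial>lebesgue_on Q)"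
proof -
  let ?h = "\<lambda>z. f z * indicator Q z"
  have h: "?h \<in> borel_measurable lebesgue"
    using f Q by (subst (asm) borel_measurable_restrict_space_iff_ennreal) auto
  then obtain g where g[measurable]: "g \<in> borel_measurable lborel" and ae: "AE z in lborel. ?h z = g z"
    using completion_ex_borel_measurable by blast
  from ae obtain N where N: "{z. ?h z \<noteq> g z} \<subseteq> N" and N0: "emeasure lborel N = 0" "N \<in> sets lborel"
    by (auto elim!: AE_E)
  have [measurable]: "N \<in> sets borel" using N0 by simp
  have NN: "N \<in> null_sets lborel" using N0 by (simp add: null_sets_def)
  define \<Phi> where "\<Phi> z = (if z \<in> N then \<infinity> else g z)" for z
  have gm: "g \<in> borel_measurable borel" using g by simp
  show ?thesis
  proof (rule that)
    show "\<Phi> \<in> borel_measurable borel" unfolding \<Phi>_def using gm by measurable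
    show "f z \<le> \<Phi> z" if "z \<in> Q" for z
    proof (cases "z \<in> N")
      case False
      then have "?h z = g z" using N by blast
      with that False show ?thesis by (simp add: \<Phi>_def)
    qed (simp add: \<Phi>_def)
    have "(\<integral>\<^sup>+z. \<Phi> z \<partial>lborel) = (\<integral>\<^sup>+z. ?h z \<partial>lborel)"
      using ae AE_not_in[OF NN] by (intro nn_integral_cong_AE, eventually_elim) (simp add: \<Phi>_def)
    also have "\<dots> = (\<integral>\<^sup>+z. ?h z \<partial>lebesgue)" by (simp add: nn_integral_completion)
    also have "\<dots> = (\<integral>\<^sup>+z. f z \<partial>lebesgue_on Q)"
      using Q by (simp add: nn_integral_restrict_space)
    finally show "(\<integral>\<^sup>+z. \<Phi> z \<partial>lborel) = (\<integral>\<^sup>+z. f z \<partial>lebesgue_on Q)" .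
  qed
qed

text \<open>Split at s = 1. Below it the power is integrable because \<beta> < 1 and
  \<open>m\<close> is bounded by 1; above it the maximum equals 1 and the exponential bound on
  \<open>m\<close> is integrated.\<close>

lemma nn_integral_powr_survival:
  fixes m :: "real \<Rightarrow> ennreal"
  assumes "\<beta> < 1" "0 \<le> \<beta>" "h > 0" and m: "\<And>s. 0 < s \<Longrightarrow> m s \<le> 1" "\<And>s. 0 < s \<Longrightarrow> m s \<le> ennreal (2 * exp (- (ln 2 / h) * s))"
  shows "(\<integral>\<^sup>+s. indicator {0<..} s * (ennreal (max 1 (s powr - \<beta>)) * m s) \<partial>lborel) \<le> ennreal (1 / (1 - \<beta>) + 2 * h / ln 2)"
proof -
  let ?a = "ln 2 / h"
  have a: "?a > 0" using assms by simp
  have "(\<integral>\<^sup>+s. indicator {0<..} s * (ennreal (max 1 (s powr - \<beta>)) * m s) \<partial>lborel)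
      \<le> (\<integral>\<^sup>+s. ennreal (indicator {0..1} s * s powr - \<beta>) + ennreal 2 * (indicator {0..} s * ennreal (exp (- ?a * s))) \<partial>lborel)"
  proof (rule nn_integral_mono)
    fix s :: real
    show "indicator {0<..} s * (ennreal (max 1 (s powr - \<beta>)) * m s)
      \<le> ennreal (indicator {0..1} s * s powr - \<beta>) + ennreal 2 * (indicator {0..} s * ennreal (exp (- ?a * s)))"
    proof (cases "0 < s")
      case True
      show ?thesis
      proof (cases "s \<le> 1")
        case s1: True
        have "s powr - \<beta> = (1 / s) powr \<beta>" using True by (simp add: powr_minus_divide powr_divide)
        also have "\<dots> \<ge> 1" using True s1 assms by (intro ge_one_powr_ge_zero) auto
        finally have "max 1 (s powr - \<beta>) = s powr - \<beta>" by simp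
        then have "ennreal (max 1 (s powr - \<beta>)) * m s \<le> ennreal (s powr - \<beta>) * 1"
          using m(1)[OF True] by (intro mult_mono) auto
        then show ?thesis using True s1 by (simp add: add_increasing2)
      next
        case False
        have "s powr - \<beta> \<le> s powr 0" using False assms by (intro powr_mono) auto
        then have "max 1 (s powr - \<beta>) = 1" using False by simp
        then show ?thesis using True False m(2)[OF True] by (simp add: ennreal_mult)
      qed
    qed simp
  qed
  also have "\<dots> = (\<integral>\<^sup>+s. ennreal (indicator {0..1} s * s powr - \<beta>) \<partial>lborel) + ennreal 2 * (\<integral>\<^sup>+s. indicator {0..} s * ennreal (exp (- ?a * s)) \<partial>lborel)"
    by (simp add: nn_integral_add nn_integral_cmult)
  also have "(\<integral>\<^sup>+s. ennreal (indicator {0..1} s * s powr - \<beta>) \<partial>lborel) = ennreal (1 / (1 - \<beta>))"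
    using has_integral_powr_from_0[of "- \<beta>" 1] assms
    by (intro nn_integral_has_integral_lebesgue[THEN trans]) (auto simp: mult.commute)
  also have "(\<integral>\<^sup>+s. indicator {0..} s * ennreal (exp (- ?a * s)) \<partial>lborel) = ennreal (h / ln 2)"
  proof -
    have "(\<integral>\<^sup>+s. ennreal (exp (- ?a * s)) * indicator {0..} s \<partial>lborel) = ennreal (0 - (- exp (- ?a * 0) / ?a))"
    proof (rule nn_integral_FTC_atLeast)
      have lim: "filterlim (\<lambda>s. - (?a * s)) at_bot at_top"
        using a by (intro filterlim_compose[OF filterlim_uminus_at_bot_at_top] filterlim_tendsto_pos_mult_at_top[OF tendsto_const _ filterlim_ident])
      have "((\<lambda>s. - exp (- (?a * s)) / ?a) \<longlongrightarrow> - 0 / ?a) at_top"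
        using a by (intro tendsto_intros filterlim_compose[OF exp_at_bot lim]) auto
      then show "((\<lambda>s. - exp (- ?a * s) / ?a) \<longlongrightarrow> 0) at_top" by simp
    qed (use assms in \<open>auto intro!: derivative_eq_intros\<close>)
    then show ?thesis by (simp add: mult.commute)
  qed
  also have "ennreal (1 / (1 - \<beta>)) + ennreal 2 * ennreal (h / ln 2) = ennreal (1 / (1 - \<beta>) + 2 * h / ln 2)"
  proof -
    have "ennreal 2 * ennreal (h / ln 2) = ennreal (2 * h / ln 2)"
      using assms by (subst ennreal_mult[symmetric]) auto
    then show ?thesis using assms by (simp only: ennreal_plus[symmetric] divide_nonneg_nonneg) (simp flip: ennreal_plus)
  qed
  finally show ?thesis .
qed

text \<open>The last claim is where right-continuity and openness meet: a position inside
  \<open>D\<close> at \<sigma> < r would keep the path in \<open>D\<close> for a while longer,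
  contradicting that \<sigma> is the infimum of the times spent outside.\<close>

lemma capped_exit_time:
  fixes Y :: "real \<Rightarrow> 'w \<Rightarrow> 'a::topological_space"
  assumes "open D" "0 \<le> r" and cont: "\<And>s. 0 \<le> s \<Longrightarrow> continuous (at s within {s..}) (\<lambda>s. Y s \<omega>)"
  defines "\<sigma> \<equiv> capped_exit_time D Y r \<omega>"
  shows "0 \<le> \<sigma>" "\<sigma> \<le> r" "\<And>s. 0 < s \<Longrightarrow> s < \<sigma> \<Longrightarrow> Y s \<omega> \<in> D" "\<sigma> < r \<Longrightarrow> Y \<sigma> \<omega> \<notin> D"
proof -
  let ?E = "{t. 0 < t \<and> Y t \<omega> \<notin> D}"
  let ?I = "exit_time D Y \<omega>"
  have I: "?I = Inf (ereal ` ?E)" by (simp add: exit_time_def)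
  have I0: "0 \<le> ?I" unfolding I by (rule Inf_greatest) auto
  have m: "0 \<le> min (ereal r) ?I" "min (ereal r) ?I \<le> ereal r" using I0 assms by auto
  \<comment> \<open>The minimum lies between 0 and the finite \<open>r\<close>, so
    \<open>real_of_ereal\<close> loses nothing, even when the path never leaves \<open>D\<close> and
    the exit time is infinite.\<close>
  then have \<sigma>: "ereal \<sigma> = min (ereal r) ?I"
    unfolding \<sigma>_def capped_exit_time_def by (cases "min (ereal r) ?I") auto
  show 0: "0 \<le> \<sigma>" and "\<sigma> \<le> r" using m unfolding \<sigma>[symmetric] by auto
  show "Y s \<omega> \<in> D" if "0 < s" "s < \<sigma>" for s
  proof (rule ccontr)
    assume "Y s \<omega> \<notin> D"
    then have "?I \<le> ereal s" unfolding I using that by (intro Inf_lower) auto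
    moreover have "ereal \<sigma> \<le> ?I" unfolding \<sigma> by simp
    ultimately have "ereal \<sigma> \<le> ereal s" by (rule order_trans[rotated])
    with that show False by simp
  qed
  show "Y \<sigma> \<omega> \<notin> D" if "\<sigma> < r"
  proof
    assume "Y \<sigma> \<omega> \<in> D"
    have I\<sigma>: "?I = ereal \<sigma>" using \<sigma> that by (auto simp: min_def split: if_splits)
    have "\<forall>\<^sub>F s in at \<sigma> within {\<sigma>..}. Y s \<omega> \<in> D"
      using cont[OF 0] \<open>open D\<close> \<open>Y \<sigma> \<omega> \<in> D\<close> unfolding continuous_within by (rule topological_tendstoD)
    then obtain d where d: "d > 0" "\<And>s. s \<in> {\<sigma>..} \<Longrightarrow> s \<noteq> \<sigma> \<Longrightarrow> dist s \<sigma> < d \<Longrightarrow> Y s \<omega> \<in> D"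
      unfolding eventually_at by auto
    have "ereal (\<sigma> + d) \<le> ?I"
      unfolding I
    proof (rule Inf_greatest, clarsimp)
      fix s assume s: "0 < s" "Y s \<omega> \<notin> D"
      have "?I \<le> ereal s" unfolding I using s by (intro Inf_lower) auto
      then have "\<sigma> \<le> s" using I\<sigma> by simp
      moreover have "s \<noteq> \<sigma>" using s \<open>Y \<sigma> \<omega> \<in> D\<close> by auto
      ultimately show "\<sigma> + d \<le> s" using d(2)[of s] s by (force simp: dist_real_def)
    qed
    then show False using I\<sigma> d(1) by simp
  qed
qed

section \<open>A measurable majorant of the source along the path\<close>

lemma (in subordination) Z_measurable_compose [measurable (raw)]:
  assumes [measurable]: "g \<in> borel_measurable N" "k \<in> N \<rightarrow>\<^sub>M M"
  shows "(\<lambda>x. Z (g x) (k x)) \<in> borel_measurable N"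
proof -
  have "(\<lambda>x. Z (fst (g x, k x)) (snd (g x, k x))) \<in> borel_measurable N"
    by (rule measurable_compose[OF _ Z_measurable_pair]) measurable
  then show ?thesis by simp
qed

lemma (in subordination) survives_measurable [measurable (raw)]:
  assumes [measurable]: "g \<in> borel_measurable N" "k \<in> N \<rightarrow>\<^sub>M M" "D \<in> sets borel"
  shows "Measurable.pred N (\<lambda>y. survives D x h (g y) (k y))"
  unfolding survives_def by measurable

lemma (in subordination) nn_integral_survives:
  assumes [measurable]: "D \<in> sets borel"
  shows "(\<integral>\<^sup>+\<omega>. (if survives D x h s \<omega> then 1 else 0) \<partial>M) = emeasure M {\<omega>\<in>space M. survives D x h s \<omega>}"
proof -
  have "(\<integral>\<^sup>+\<omega>. (if survives D x h s \<omega> then 1 else 0) \<partial>M) = (\<integral>\<^sup>+\<omega>. indicator {\<omega>\<in>space M. survives D x h s \<omega>} \<omega> \<partial>M)"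
    by (intro nn_integral_cong) (simp add: indicator_def)
  also have "\<dots> = emeasure M {\<omega>\<in>space M. survives D x h s \<omega>}"
    by (rule nn_integral_indicator) measurable
  finally show ?thesis .
qed

lemma (in subordination) emeasure_survives_measurable:
  assumes D[measurable]: "D \<in> sets borel"
  shows "(\<lambda>s. emeasure M {\<omega>\<in>space M. survives D x h s \<omega>}) \<in> borel_measurable borel"
proof -
  have "(\<lambda>s. \<integral>\<^sup>+\<omega>. (if survives D x h s \<omega> then 1 else 0) \<partial>M) \<in> borel_measurable borel"
    by measurable
  then show ?thesis by (simp add: nn_integral_survives[OF D])
qed

text \<open>The right-hand side of the weighted Young inequality along the path, with \<Phi> in the
  role of a majorant of |f|^p. The event \<open>survives\<close> stands in for the time s being
  before exit, which keeps the integrand jointly measurable.\<close>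

definition (in subordination) occupation ::
    "'a set \<Rightarrow> 'a \<Rightarrow> real \<Rightarrow> real \<Rightarrow> real \<Rightarrow> (real \<Rightarrow> real) \<Rightarrow> (real \<times> 'a \<Rightarrow> ennreal) \<Rightarrow> real \<Rightarrow> real \<Rightarrow> real \<Rightarrow> 'w \<Rightarrow> real \<Rightarrow> ennreal" where
  "occupation D x h t r K \<Phi> a b q \<omega> s = indicator {0<..<r} s *
    (ennreal a * (\<Phi> (t + s, x + Z s \<omega>) * ennreal (1 / K s)) +
     ennreal b * (ennreal (K s powr q) * (if survives D x h s \<omega> then 1 else 0)))"

lemma (in subordination) occupation_measurable:
  assumes [measurable]: "K \<in> borel_measurable borel" "D \<in> sets borel" and \<Phi>: "\<Phi> \<in> borel_measurable borel"
  shows "(\<lambda>(\<omega>, s). occupation D x h t r K \<Phi> a b q \<omega> s) \<in> borel_measurable (M \<Otimes>\<^sub>M lborel)"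
proof -
  have [measurable]: "\<Phi> \<in> borel_measurable (borel \<Otimes>\<^sub>M borel)"
    using \<Phi> by (simp add: borel_prod)
  show ?thesis unfolding occupation_def split_beta by measurable
qed

text \<open>After exchanging the integrals, the weight \<open>1 / K s\<close> cancels the density
  bound exactly, leaving the plain space-time integral of \<Phi>. Hence the bound is free of
  \<open>t\<close> and \<open>r\<close>.\<close>

lemma (in subordination) occupation_bound:
  assumes K[measurable]: "K \<in> borel_measurable borel" and K0: "\<And>s. 0 < s \<Longrightarrow> 0 < K s"
    and D[measurable]: "D \<in> sets borel" and \<Phi>: "\<Phi> \<in> borel_measurable borel"
    and heat: "\<And>s g. 0 < s \<Longrightarrow> g \<in> borel_measurable borel \<Longrightarrow> (\<integral>\<^sup>+\<omega>. g (x + Z s \<omega>) \<partial>M) \<le> ennreal (K s) * (\<integral>\<^sup>+y. g y \<partial>lborel)"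
  shows "(\<integral>\<^sup>+\<omega>. \<integral>\<^sup>+s. occupation D x h t r K \<Phi> a b q \<omega> s \<partial>lborel \<partial>M)
    \<le> ennreal a * (\<integral>\<^sup>+z. \<Phi> z \<partial>lborel) +
      ennreal b * (\<integral>\<^sup>+s. indicator {0<..} s * (ennreal (K s powr q) * emeasure M {\<omega>\<in>space M. survives D x h s \<omega>}) \<partial>lborel)"
proof -
  interpret pair_sigma_finite M "lborel :: real measure" ..
  have \<Phi>2[measurable]: "\<Phi> \<in> borel_measurable (borel \<Otimes>\<^sub>M borel)"
    using \<Phi> by (simp add: borel_prod)
  note emeasure_survives_measurable[OF D, measurable]
  have "(\<integral>\<^sup>+\<omega>. \<integral>\<^sup>+s. occupation D x h t r K \<Phi> a b q \<omega> s \<partial>lborel \<partial>M) = (\<integral>\<^sup>+s. \<integral>\<^sup>+\<omega>. occupation D x h t r K \<Phi> a b q \<omega> s \<partial>M \<partial>lborel)"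
    by (rule Fubini'[symmetric]) (rule occupation_measurable[OF K D \<Phi>])
  \<comment> \<open>The integrand on the left vanishes outside (0,r), so the first summand may be
    kept for all real s. This makes the shift by \<open>t\<close> a translation of the whole
    line.\<close>
  also have "\<dots> \<le> (\<integral>\<^sup>+s. ennreal a * (\<integral>\<^sup>+y. \<Phi> (t + s, y) \<partial>lborel) +
      ennreal b * (indicator {0<..} s * (ennreal (K s powr q) * emeasure M {\<omega>\<in>space M. survives D x h s \<omega>})) \<partial>lborel)"
  proof (rule nn_integral_mono)
    fix s :: real
    show "(\<integral>\<^sup>+\<omega>. occupation D x h t r K \<Phi> a b q \<omega> s \<partial>M) \<le> ennreal a * (\<integral>\<^sup>+y. \<Phi> (t + s, y) \<partial>lborel) +
      ennreal b * (indicator {0<..} s * (ennreal (K s powr q) * emeasure M {\<omega>\<in>space M. survives D x h s \<omega>}))"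
    proof (cases "0 < s \<and> s < r")
      case True
      have [measurable]: "(\<lambda>y. \<Phi> (t + s, y)) \<in> borel_measurable borel" by measurable
      have "(\<integral>\<^sup>+\<omega>. occupation D x h t r K \<Phi> a b q \<omega> s \<partial>M) =
        ennreal a * ((\<integral>\<^sup>+\<omega>. \<Phi> (t + s, x + Z s \<omega>) \<partial>M) * ennreal (1 / K s)) +
        ennreal b * (ennreal (K s powr q) * (\<integral>\<^sup>+\<omega>. (if survives D x h s \<omega> then 1 else 0) \<partial>M))"
        unfolding occupation_def using True by (simp add: nn_integral_add nn_integral_cmult nn_integral_multc)
      also have "(\<integral>\<^sup>+\<omega>. (if survives D x h s \<omega> then 1 else 0) \<partial>M) = emeasure M {\<omega>\<in>space M. survives D x h s \<omega>}"
        by (rule nn_integral_survives[OF D])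
      also have "(\<integral>\<^sup>+\<omega>. \<Phi> (t + s, x + Z s \<omega>) \<partial>M) * ennreal (1 / K s) \<le> (ennreal (K s) * (\<integral>\<^sup>+y. \<Phi> (t + s, y) \<partial>lborel)) * ennreal (1 / K s)"
        using True by (intro mult_right_mono heat) auto
      also have "\<dots> = (ennreal (K s) * ennreal (1 / K s)) * (\<integral>\<^sup>+y. \<Phi> (t + s, y) \<partial>lborel)"
        by (simp only: mult_ac)
      also have "ennreal (K s) * ennreal (1 / K s) = 1"
        using K0[of s] True by (simp add: ennreal_mult[symmetric])
      finally show ?thesis using True by (simp add: mult_left_mono add_right_mono)
    qed (simp add: occupation_def)
  qed
  also have "\<dots> = ennreal a * (\<integral>\<^sup>+s. \<integral>\<^sup>+y. \<Phi> (t + s, y) \<partial>lborel \<partial>lborel) +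
      ennreal b * (\<integral>\<^sup>+s. indicator {0<..} s * (ennreal (K s powr q) * emeasure M {\<omega>\<in>space M. survives D x h s \<omega>}) \<partial>lborel)"
    by (simp add: nn_integral_add nn_integral_cmult)
  also have "(\<integral>\<^sup>+s. \<integral>\<^sup>+y. \<Phi> (t + s, y) \<partial>lborel \<partial>lborel) = (\<integral>\<^sup>+s. \<integral>\<^sup>+y. \<Phi> (s, y) \<partial>lborel \<partial>lborel)"
    using nn_integral_real_affine[of "\<lambda>s. \<integral>\<^sup>+y. \<Phi> (s, y) \<partial>lborel" 1 t] by simp
  also have "\<dots> = (\<integral>\<^sup>+z. \<Phi> z \<partial>(lborel \<Otimes>\<^sub>M lborel))"
    by (rule lborel.nn_integral_fst) simp
  finally show ?thesis by (simp add: lborel_prod)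
qed

section \<open>The maximum principle\<close>

context subordination
begin

lemma good_path_exit_time:
  fixes x :: 'a
  assumes "open D" "0 \<le> r" "good_path \<omega>"
  defines "\<sigma> \<equiv> capped_exit_time D (started_at x X) r \<omega>"
  shows "0 \<le> \<sigma>" "\<sigma> \<le> r" "\<And>s. 0 < s \<Longrightarrow> s < \<sigma> \<Longrightarrow> x + X s \<omega> \<in> D" "\<sigma> < r \<Longrightarrow> x + X \<sigma> \<omega> \<notin> D"
proof -
  have "continuous (at s within {s..}) (\<lambda>s. started_at x X s \<omega>)" if "0 \<le> s" for s
    unfolding started_at_def
    by (intro continuous_intros good_path_X_right_continuous assms that)
  from capped_exit_time[where Y="started_at x X" and \<omega>=\<omega>, OF \<open>open D\<close> \<open>0 \<le> r\<close> this]
  show "0 \<le> \<sigma>" "\<sigma> \<le> r" "\<And>s. 0 < s \<Longrightarrow> s < \<sigma> \<Longrightarrow> x + X s \<omega> \<in> D" "\<sigma> < r \<Longrightarrow> x + X \<sigma> \<omega> \<notin> D"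
    unfolding \<sigma>_def by (auto simp: started_at_def)
qed

lemma prob_space_completion: "prob_space (completion M)"
  by (rule prob_spaceI) (simp add: emeasure_space_1)

text \<open>At the capped exit time the path is either outside \<open>D\<close> before time T or it
  has reached time T. The weight enters only through its bounds 0 and 1, and replacing \<phi> by its
  positive part allows it to be discarded.\<close>

lemma boundary_term_le:
  fixes x :: 'a and \<phi> :: "real \<times> 'a \<Rightarrow> real"
  assumes "open D" "bounded D" "D \<noteq> {}" "T > 0" "0 \<le> t" "t < T"
    and cont: "continuous_on ({0..T} \<times> UNIV) \<phi>" and bdd: "bounded (\<phi> ` ({0..T} \<times> UNIV))"
    and weight: "\<And>s \<omega>. 0 \<le> s \<Longrightarrow> 0 \<le> weight s \<omega> \<and> weight s \<omega> \<le> (1::real)"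
  defines "\<sigma> \<equiv> capped_exit_time D (started_at x X) (T - t)"
  shows "0 \<le> max (SUP z\<in>{0..<T} \<times> (- D). max (\<phi> z) 0) (SUP z\<in>{T} \<times> D. max (\<phi> z) 0)" (is "_ \<le> max ?m1 ?m2")
    and "(\<integral>\<omega>. weight (\<sigma> \<omega>) \<omega> * \<phi> (t + \<sigma> \<omega>, started_at x X (\<sigma> \<omega>) \<omega>) \<partial>completion M)
    \<le> max (SUP z\<in>{0..<T} \<times> (- D). max (\<phi> z) 0) (SUP z\<in>{T} \<times> D. max (\<phi> z) 0)" (is "?B \<le> _")
proof -
  obtain L where L: "\<And>z. z \<in> {0..T} \<times> UNIV \<Longrightarrow> \<bar>\<phi> z\<bar> \<le> L"
    using bdd unfolding bounded_iff by auto
  have L0: "0 \<le> L" using L[of "(0, x)"] \<open>T > 0\<close> by force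
  have bdd_above: "bdd_above ((\<lambda>z. max (\<phi> z) 0) ` A)" if "A \<subseteq> {0..T} \<times> UNIV" for A
  proof (rule bdd_aboveI2)
    fix z assume "z \<in> A"
    then show "max (\<phi> z) 0 \<le> L" using L[of z] L0 that by auto
  qed
  have m1: "max (\<phi> (s, y)) 0 \<le> ?m1" if "0 \<le> s" "s < T" "y \<notin> D" for s y
    using that by (intro cSUP_upper bdd_above) auto
  have m2: "max (\<phi> (T, y)) 0 \<le> ?m2" if "y \<in> D" for y
    using that \<open>T > 0\<close> by (intro cSUP_upper bdd_above) auto
  \<comment> \<open>The path may sit outside \<open>D\<close> exactly at time T, a point covered by
    neither supremum. Continuity of \<phi> reaches it from the times T - T/(n+1), which lie in
    [0,T).\<close>
  have m1T: "max (\<phi> (T, y)) 0 \<le> ?m1" if "y \<notin> D" for y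
  proof (rule LIMSEQ_le_const2)
    let ?s = "\<lambda>n. T - T * (1 / real (Suc n))"
    have s: "0 \<le> ?s n" "?s n < T" for n
    proof -
      have "1 / real (Suc n) \<le> 1" by simp
      then have "T * (1 / real (Suc n)) \<le> T * 1" using \<open>T > 0\<close> by (intro mult_left_mono) auto
      then show "0 \<le> ?s n" by simp
      show "?s n < T" using \<open>T > 0\<close> by simp
    qed
    have "(\<lambda>n. (?s n, y)) \<longlonglongrightarrow> (T - T * 0, y)"
      by (intro tendsto_intros LIMSEQ_Suc lim_1_over_n)
    then have "(\<lambda>n. \<phi> (?s n, y)) \<longlonglongrightarrow> \<phi> (T, y)"
      using s \<open>T > 0\<close> by (intro continuous_on_tendsto_compose[OF cont]) (auto intro!: always_eventually less_imp_le)
    then show "(\<lambda>n. max (\<phi> (?s n, y)) 0) \<longlonglongrightarrow> max (\<phi> (T, y)) 0"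
      by (intro tendsto_max tendsto_const)
    show "\<exists>N. \<forall>n\<ge>N. max (\<phi> (?s n, y)) 0 \<le> ?m1"
      using m1[OF s that] by blast
  qed
  obtain y0 where "y0 \<in> D" using \<open>D \<noteq> {}\<close> by blast
  then show m0: "0 \<le> max ?m1 ?m2" using m2[of y0] by (simp add: le_max_iff_disj)
  have ae: "AE \<omega> in completion M. weight (\<sigma> \<omega>) \<omega> * \<phi> (t + \<sigma> \<omega>, started_at x X (\<sigma> \<omega>) \<omega>) \<le> max ?m1 ?m2"
  proof (rule AE_completion)
    show "AE \<omega> in M. weight (\<sigma> \<omega>) \<omega> * \<phi> (t + \<sigma> \<omega>, started_at x X (\<sigma> \<omega>) \<omega>) \<le> max ?m1 ?m2"
      using AE_good_path
    proof eventually_elim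
      case (elim \<omega>)
      have "0 \<le> T - t" using assms by simp
      note ex = good_path_exit_time[OF \<open>open D\<close> this elim, where x=x, folded \<sigma>_def]
      let ?y = "x + X (\<sigma> \<omega>) \<omega>"
      have "max (\<phi> (t + \<sigma> \<omega>, ?y)) 0 \<le> max ?m1 ?m2"
      proof (cases "\<sigma> \<omega> < T - t")
        case True
        then show ?thesis
          using m1[of "t + \<sigma> \<omega>" ?y] ex \<open>0 \<le> t\<close> by (simp add: le_max_iff_disj)
      next
        case False
        then have "t + \<sigma> \<omega> = T" using ex(2) by simp
        then show ?thesis
          using m1T[of ?y] m2[of ?y] by (cases "?y \<in> D") (simp_all add: le_max_iff_disj)
      qed
      moreover have "weight (\<sigma> \<omega>) \<omega> * \<phi> (t + \<sigma> \<omega>, ?y) \<le> weight (\<sigma> \<omega>) \<omega> * max (\<phi> (t + \<sigma> \<omega>, ?y)) 0"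
        using weight[OF ex(1)] by (intro mult_left_mono) auto
      moreover have "\<dots> \<le> 1 * max (\<phi> (t + \<sigma> \<omega>, ?y)) 0"
        using weight[OF ex(1)] by (intro mult_right_mono) auto
      ultimately show ?case unfolding started_at_def mult_1 by (meson order_trans)
    qed
  qed
  \<comment> \<open>If the integrand fails to be integrable, the expectation is 0 by convention, and
    nonnegativity of the bound suffices.\<close>
  show "?B \<le> max ?m1 ?m2"
  proof (cases "integrable (completion M) (\<lambda>\<omega>. weight (\<sigma> \<omega>) \<omega> * \<phi> (t + \<sigma> \<omega>, started_at x X (\<sigma> \<omega>) \<omega>))")
    case True
    then show ?thesis by (rule prob_space.integral_le_const[OF prob_space_completion _ ae])
  next
    case False
    then show ?thesis using m0 by (simp add: not_integrable_integral_eq)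
  qed
qed

text \<open>The optimisation in the Young parameter, with \<open>N\<close> bounding the survival
  integral. A positive upper bound \<open>G\<close> replaces the norm because the optimal parameter
  involves a negative power of it, which degenerates when the norm is 0.\<close>

lemma source_term_le:
  fixes x :: 'a and f :: "real \<times> 'a \<Rightarrow> real"
  assumes D: "open D" and t: "0 \<le> t" "t < T"
    and weight: "\<And>s \<omega>. 0 \<le> s \<Longrightarrow> 0 \<le> weight s \<omega> \<and> weight s \<omega> \<le> (1::real)"
    and p: "p > 1" "1 / p + 1 / p' = 1"
    and K: "K \<in> borel_measurable borel" "\<And>s. 0 < s \<Longrightarrow> 0 < K s"
    and heat: "\<And>s g. 0 < s \<Longrightarrow> g \<in> borel_measurable borel \<Longrightarrow> (\<integral>\<^sup>+\<omega>. g (x + Z s \<omega>) \<partial>M) \<le> ennreal (K s) * (\<integral>\<^sup>+y. g y \<partial>lborel)"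
    and "h > 0" "N > 0" and N: "(\<integral>\<^sup>+s. indicator {0<..} s * (ennreal (K s powr (p' - 1)) * emeasure M {\<omega>\<in>space M. survives D x h s \<omega>}) \<partial>lborel) \<le> ennreal N"
    and f: "in_Lp p ({0..<T} \<times> D) f" and G: "Lp_norm p ({0..<T} \<times> D) f \<le> G" "0 < G"
  defines "\<sigma> \<equiv> capped_exit_time D (started_at x X) (T - t)"
  shows "(\<integral>\<omega>. (LINT s:{0..\<sigma> \<omega>}|lebesgue. weight s \<omega> * f (t + s, started_at x X s \<omega>)) \<partial>completion M) \<le> N powr (1 / p') * G"
proof -
  let ?Q = "{0..<T} \<times> D"
  let ?J = "\<lambda>\<omega>. LINT s:{0..\<sigma> \<omega>}|lebesgue. weight s \<omega> * f (t + s, started_at x X s \<omega>)"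
  define I where "I = (\<integral>z. \<bar>f z\<bar> powr p \<partial>lebesgue_on ?Q)"
  have I0: "0 \<le> I" unfolding I_def by simp
  have p'1: "p' > 1" using p by (rule conjugate_exponent_gt_1)
  have Db[measurable]: "D \<in> sets borel" using D by simp
  have Qb: "?Q \<in> sets borel"
  proof -
    have "?Q \<in> sets (borel \<Otimes>\<^sub>M borel)" by measurable
    then show ?thesis by (simp only: borel_prod)
  qed
  have fm: "(\<lambda>z. ennreal (\<bar>f z\<bar> powr p)) \<in> borel_measurable (lebesgue_on ?Q)"
    using f unfolding in_Lp_def by auto
  obtain \<Phi> where \<Phi>: "\<Phi> \<in> borel_measurable borel" "\<And>z. z \<in> ?Q \<Longrightarrow> ennreal (\<bar>f z\<bar> powr p) \<le> \<Phi> z"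
    "(\<integral>\<^sup>+z. \<Phi> z \<partial>lborel) = (\<integral>\<^sup>+z. ennreal (\<bar>f z\<bar> powr p) \<partial>lebesgue_on ?Q)"
    using borel_majorant[OF fm Qb] by blast
  have \<Phi>I: "(\<integral>\<^sup>+z. \<Phi> z \<partial>lborel) = ennreal I"
    unfolding \<Phi>(3) I_def using f unfolding in_Lp_def by (intro nn_integral_eq_integral) auto
  have IG: "I \<le> G powr p"
  proof -
    have "(I powr (1 / p)) powr p \<le> G powr p"
      using G p unfolding Lp_norm_def I_def[symmetric] by (intro powr_mono2) auto
    then show ?thesis using I0 p by (cases "I = 0") (simp_all add: powr_powr)
  qed
  define n where "n = N powr (1 / p')"
  have n0: "n > 0" unfolding n_def using \<open>N > 0\<close> by simp
  \<comment> \<open>Chosen to balance the two Young terms: l^p G^p and l^(-p') N both equal G n.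
    With their weights 1/p and 1/p' they add up to G n.\<close>
  define l where "l = (G powr (1 - p) * n) powr (1 / p)"
  have l0: "l > 0" unfolding l_def using G n0 by simp
  define a where "a = l powr p / p"
  define b where "b = l powr - p' / p'"
  have ab: "0 \<le> a" "0 \<le> b" unfolding a_def b_def using p p'1 by auto
  have aI: "a * I \<le> G * n / p"
  proof -
    have "l powr p = G powr (1 - p) * n"
      unfolding l_def using G n0 p by (simp add: powr_powr)
    moreover have "G powr (1 - p) * G powr p = G"
      using G by (simp add: powr_add[symmetric])
    ultimately have "l powr p * G powr p = G * n" by (metis mult.commute mult.left_commute)
    moreover have "l powr p * I \<le> l powr p * G powr p" using IG by (intro mult_left_mono) auto
    ultimately show ?thesis unfolding a_def using p by (simp add: divide_right_mono)
  qed
  have bN: "b * N \<le> G * n / p'"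
  proof -
    have e1: "(1 - p) * (- p' / p) = 1" and e2: "- p' / p = 1 - p'"
      using p p'1 by (auto simp: field_simps)
    have "l powr - p' = (G powr (1 - p) * n) powr (1 / p * - p')"
      unfolding l_def by (simp only: powr_powr)
    also have "1 / p * - p' = - p' / p" by simp
    also have "(G powr (1 - p) * n) powr (- p' / p) = G powr ((1 - p) * (- p' / p)) * n powr (- p' / p)"
      by (simp only: powr_mult powr_powr)
    also have "\<dots> = G * n powr (1 - p')" unfolding e1 unfolding e2 using G by simp
    finally have "l powr - p' = G * n powr (1 - p')" .
    moreover have "N = n powr p'" unfolding n_def using \<open>N > 0\<close> p'1 by (simp add: powr_powr)
    moreover have "n powr (1 - p') * n powr p' = n" using n0 by (simp add: powr_add[symmetric])
    ultimately have "l powr - p' * N = G * n" by (metis mult.assoc)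
    then show ?thesis unfolding b_def by simp
  qed
  let ?w = "occupation D x h t (T - t) K \<Phi> a b (p' - 1)"
  \<comment> \<open>The majorant is compared with the time integral pathwise. If the path integral
    does not exist, it is 0 and the comparison is trivial.\<close>
  have J: "AE \<omega> in completion M. ennreal \<bar>?J \<omega>\<bar> \<le> (\<integral>\<^sup>+s. ?w \<omega> s \<partial>lborel)"
  proof (rule AE_completion)
    show "AE \<omega> in M. ennreal \<bar>?J \<omega>\<bar> \<le> (\<integral>\<^sup>+s. ?w \<omega> s \<partial>lborel)"
      using AE_good_path
    proof eventually_elim
      case (elim \<omega>)
      have Tt: "0 \<le> T - t" using t by simp
      note ex = good_path_exit_time[OF D Tt elim, where x=x, folded \<sigma>_def]
      let ?j = "\<lambda>s. indicator {0..\<sigma> \<omega>} s *\<^sub>R (weight s \<omega> * f (t + s, started_at x X s \<omega>))"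
      show ?case
      proof (cases "integrable lebesgue ?j")
        case True
        have "ennreal \<bar>?J \<omega>\<bar> \<le> (\<integral>\<^sup>+s. ennreal (norm (?j s)) \<partial>lebesgue)"
          unfolding set_lebesgue_integral_def using integral_norm_bound_ennreal[OF True] by simp
        also have "\<dots> \<le> (\<integral>\<^sup>+s. ?w \<omega> s \<partial>lebesgue)"
        proof (rule nn_integral_mono_AE)
          \<comment> \<open>The path is known to lie in \<open>D\<close> only strictly between 0 and
            the exit time, so the two endpoints are discarded as null sets.\<close>
          have "AE s in lebesgue. s \<noteq> 0 \<and> s \<noteq> \<sigma> \<omega>"
            using AE_lborel_singleton[of "0::real"] AE_lborel_singleton[of "\<sigma> \<omega>"]
            by (intro AE_completion AE_conjI)
          then show "AE s in lebesgue. ennreal (norm (?j s)) \<le> ?w \<omega> s"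
          proof eventually_elim
            case (elim s)
            show ?case
            proof (cases "0 < s \<and> s < \<sigma> \<omega>")
              case True
              then have s: "0 < s" "s < \<sigma> \<omega>" by auto
              have inD: "x + X s \<omega> \<in> D" using ex(3)[OF s] .
              have XZ: "Z r \<omega> = X r \<omega>" if "0 \<le> r" for r
                using good_path_Z[OF \<open>good_path \<omega>\<close> that] .
              \<comment> \<open>The sampled times k h below s are positive and smaller than the exit
                time, so the path is in \<open>D\<close> at each of them.\<close>
              have surv: "survives D x h s \<omega>"
                unfolding survives_def using \<open>h > 0\<close> s by (auto simp: XZ intro!: ex(3))
              let ?z = "(t + s, x + X s \<omega>)"
              have zQ: "?z \<in> ?Q" using inD s ex(2) t by auto
              have "norm (?j s) = weight s \<omega> * \<bar>f ?z\<bar>"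
                using s weight[of s \<omega>] by (simp add: abs_mult started_at_def)
              also have "\<dots> \<le> 1 * \<bar>f ?z\<bar>" using weight[of s \<omega>] s by (intro mult_right_mono) auto
              also have "\<dots> \<le> a * (\<bar>f ?z\<bar> powr p * (1 / K s)) + b * K s powr (p' - 1)"
                using weighted_Young[OF p, of "\<bar>f ?z\<bar>" "K s" l] K(2)[OF s(1)] l0 unfolding a_def b_def by simp
              finally have "ennreal (norm (?j s)) \<le> ennreal (a * (\<bar>f ?z\<bar> powr p * (1 / K s)) + b * K s powr (p' - 1))"
                by (rule ennreal_leI)
              also have "\<dots> = ennreal a * (ennreal (\<bar>f ?z\<bar> powr p) * ennreal (1 / K s)) + ennreal b * ennreal (K s powr (p' - 1))"
              proof -
                have "0 \<le> 1 / K s" using K(2)[OF s(1)] by simp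
                then show ?thesis
                  using ab by (simp only: ennreal_plus ennreal_mult mult_nonneg_nonneg powr_ge_zero)
              qed
              also have "\<dots> \<le> ennreal a * (\<Phi> ?z * ennreal (1 / K s)) + ennreal b * ennreal (K s powr (p' - 1))"
                by (intro add_mono mult_left_mono mult_right_mono \<Phi>(2) zQ) auto
              also have "\<dots> = ?w \<omega> s"
                unfolding occupation_def using s ex(2) surv by (simp add: XZ)
              finally show ?thesis .
            next
              case False
              with elim have "s \<notin> {0..\<sigma> \<omega>}" by auto
              then show ?thesis by simp
            qed
          qed
        qed
        also have "\<dots> = (\<integral>\<^sup>+s. ?w \<omega> s \<partial>lborel)" by (rule nn_integral_completion)
        finally show ?thesis .
      next
        case False
        then have "?J \<omega> = 0" unfolding set_lebesgue_integral_def by (rule not_integrable_integral_eq)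
        then show ?thesis by simp
      qed
    qed
  qed
  have "ennreal \<bar>\<integral>\<omega>. ?J \<omega> \<partial>completion M\<bar> \<le> ennreal (G * n)"
  proof (cases "integrable (completion M) ?J")
    case True
    have "ennreal \<bar>\<integral>\<omega>. ?J \<omega> \<partial>completion M\<bar> \<le> (\<integral>\<^sup>+\<omega>. ennreal \<bar>?J \<omega>\<bar> \<partial>completion M)"
      using integral_norm_bound_ennreal[OF True] by simp
    also have "\<dots> \<le> (\<integral>\<^sup>+\<omega>. \<integral>\<^sup>+s. ?w \<omega> s \<partial>lborel \<partial>completion M)"
      by (rule nn_integral_mono_AE[OF J])
    also have "\<dots> = (\<integral>\<^sup>+\<omega>. \<integral>\<^sup>+s. ?w \<omega> s \<partial>lborel \<partial>M)"
      by (rule nn_integral_completion)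
    also have "\<dots> \<le> ennreal a * (\<integral>\<^sup>+z. \<Phi> z \<partial>lborel) +
      ennreal b * (\<integral>\<^sup>+s. indicator {0<..} s * (ennreal (K s powr (p' - 1)) * emeasure M {\<omega>\<in>space M. survives D x h s \<omega>}) \<partial>lborel)"
      by (rule occupation_bound[OF K Db \<Phi>(1) heat])
    also have "\<dots> \<le> ennreal a * ennreal I + ennreal b * ennreal N"
      unfolding \<Phi>I by (intro add_left_mono mult_left_mono N) auto
    also have "\<dots> = ennreal (a * I + b * N)"
      using ab I0 \<open>N > 0\<close> by (simp add: ennreal_mult ennreal_plus)
    also have "\<dots> \<le> ennreal (G * n)"
    proof (rule ennreal_leI)
      have "G * n / p + G * n / p' = G * n * (1 / p + 1 / p')" by (simp only: distrib_left times_divide_eq_right mult_1_right)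
      then show "a * I + b * N \<le> G * n" using aI bN unfolding p(2) by simp
    qed
    finally show ?thesis .
  qed (simp add: not_integrable_integral_eq)
  then have "\<bar>\<integral>\<omega>. ?J \<omega> \<partial>completion M\<bar> \<le> G * n"
    using G n0 by (subst (asm) ennreal_le_iff) auto
  then show ?thesis unfolding n_def by (simp add: mult.commute)
qed

text \<open>Combines the boundary and source bounds with explicit constants. The diameter enters
  only through the sampling step \<kappa>/\<Psi>(diam^-2) in the survival integral; \<open>C\<close>
  and \<delta> come from the density bound.\<close>

lemma subsolution_le:
  fixes V f \<phi> :: "real \<times> 'a \<Rightarrow> real"
  assumes \<Psi>: "bernstein0 \<Psi>" "strict_mono_on {0<..} \<Psi>"
    and p: "p > 1" "1 / p + 1 / p' = 1" and \<delta>: "0 < \<delta>" "\<delta> * (p' - 1) < 1" and "0 < C" "0 < \<kappa>"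
    and C: "\<And>s. 0 < s \<Longrightarrow> \<exists>\<psi>\<in>borel_measurable borel.
      (\<forall>\<xi>::'a. \<xi> \<noteq> 0 \<longrightarrow> ennreal (exp (- s * \<Psi> ((norm \<xi>)\<^sup>2))) \<le> \<psi> \<xi>) \<and>
      (\<integral>\<^sup>+\<xi>. \<psi> \<xi> \<partial>lborel) \<le> ennreal (C * max 1 (s powr - \<delta>))"
    and \<kappa>: "exp (1 / 2) * (\<integral>w. std_normal_density w * exp (- \<kappa> * (min (w\<^sup>2) 1 / 2)) \<partial>lborel) \<le> 1 / 2"
    and D: "D \<noteq> {}" "open D" "bounded D" and "T > 0" and V: "\<forall>z\<in>{0..} \<times> UNIV. 0 \<le> V z"
    and f: "in_Lp p ({0..<T} \<times> D) f" and bdd: "bounded (\<phi> ` ({0..T} \<times> UNIV))"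
    and sub: "parabolic_weak_subsolution M X D V T f \<phi>"
  defines "\<beta> \<equiv> \<delta> * (p' - 1)"
  shows "(SUP z\<in>{0..<T} \<times> D. max (\<phi> z) 0) \<le>
    max (SUP z\<in>{0..<T} \<times> (- D). max (\<phi> z) 0) (SUP z\<in>{T} \<times> D. max (\<phi> z) 0)
    + (C powr (p' - 1) * (1 / (1 - \<beta>) + 2 * (\<kappa> / \<Psi> (diameter D powr - 2)) / ln 2)) powr (1 / p') * Lp_norm p ({0..<T} \<times> D) f"
    (is "_ \<le> ?m + ?N powr _ * ?G")
proof (rule cSUP_least)
  show "{0..<T} \<times> D \<noteq> {}" using D \<open>T > 0\<close> by simp
  fix z assume "z \<in> {0..<T} \<times> D"
  then obtain t x where z: "z = (t, x)" and t: "0 \<le> t" "t < T" and x: "x \<in> D" by auto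
  have p'1: "p' > 1" using p by (rule conjugate_exponent_gt_1)
  have \<beta>: "0 \<le> \<beta>" "\<beta> < 1" unfolding \<beta>_def using \<delta> p'1 by auto
  let ?R = "diameter D"
  have R: "?R > 0" using D(2,3,1) by (rule diameter_pos)
  have pos: "0 < \<Psi> u" if "0 < u" for u using \<Psi> that by (rule bernstein0_pos)
  \<comment> \<open>The step for which \<open>h\<close> times \<Psi>(diam^-2) is exactly \<kappa>,
    so the universal smallness condition applies to every domain.\<close>
  define h where "h = \<kappa> / \<Psi> (?R powr - 2)"
  have h: "h > 0" unfolding h_def using pos[of "?R powr - 2"] R \<open>0 < \<kappa>\<close> by simp
  have h\<Psi>: "h * \<Psi> (?R powr - 2) = \<kappa>" unfolding h_def using pos[of "?R powr - 2"] R by simp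
  define K where "K s = C * max 1 (s powr - \<delta>)" for s
  have K: "K \<in> borel_measurable borel" unfolding K_def by measurable
  have K0: "0 < K s" for s unfolding K_def using \<open>0 < C\<close> by simp
  have Kq: "K s powr (p' - 1) = C powr (p' - 1) * max 1 (s powr - \<beta>)" for s
  proof -
    have eq: "(s powr - \<delta>) powr (p' - 1) = s powr - \<beta>"
      unfolding \<beta>_def powr_powr by simp
    have "max 1 (s powr - \<delta>) powr (p' - 1) = max 1 (s powr - \<beta>)"
    proof (cases "1 \<le> s powr - \<delta>")
      case True
      have "1 \<le> (s powr - \<delta>) powr (p' - 1)"
        by (rule ge_one_powr_ge_zero[OF True]) (use p'1 in simp)
      then show ?thesis using True unfolding eq[symmetric] by (simp only: max_absorb2)
    next
      case False
      have "(s powr - \<delta>) powr (p' - 1) \<le> 1"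
        using False p'1 by (intro powr_le1) auto
      then show ?thesis using False unfolding eq[symmetric] by (simp only: max_absorb1 not_le less_imp_le powr_one_eq_one)
    qed
    then show ?thesis unfolding K_def by (simp add: powr_mult)
  qed
  have heat: "(\<integral>\<^sup>+\<omega>. g (x + Z s \<omega>) \<partial>M) \<le> ennreal (K s) * (\<integral>\<^sup>+y. g y \<partial>lborel)"
    if "0 < s" "g \<in> borel_measurable borel" for s and g :: "'a \<Rightarrow> ennreal"
  proof -
    obtain \<psi> where "\<psi> \<in> borel_measurable borel" "\<forall>\<xi>::'a. \<xi> \<noteq> 0 \<longrightarrow> ennreal (exp (- s * \<Psi> ((norm \<xi>)\<^sup>2))) \<le> \<psi> \<xi>"
      "(\<integral>\<^sup>+\<xi>. \<psi> \<xi> \<partial>lborel) \<le> ennreal (K s)"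
      using C[OF \<open>0 < s\<close>] unfolding K_def by blast
    then show ?thesis using that by (intro nn_integral_Z_le) auto
  qed
  have Db: "D \<in> sets borel" using D by simp
  note emeasure_survives_measurable[OF Db, measurable]
  have N: "(\<integral>\<^sup>+s. indicator {0<..} s * (ennreal (K s powr (p' - 1)) * emeasure M {\<omega>\<in>space M. survives D x h s \<omega>}) \<partial>lborel) \<le> ennreal ?N"
  proof -
    have "(\<integral>\<^sup>+s. indicator {0<..} s * (ennreal (K s powr (p' - 1)) * emeasure M {\<omega>\<in>space M. survives D x h s \<omega>}) \<partial>lborel)
      = (\<integral>\<^sup>+s. ennreal (C powr (p' - 1)) * (indicator {0<..} s * (ennreal (max 1 (s powr - \<beta>)) * emeasure M {\<omega>\<in>space M. survives D x h s \<omega>})) \<partial>lborel)"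
      unfolding Kq by (intro nn_integral_cong) (simp add: ennreal_mult mult_ac)
    also have "\<dots> = ennreal (C powr (p' - 1)) * (\<integral>\<^sup>+s. indicator {0<..} s * (ennreal (max 1 (s powr - \<beta>)) * emeasure M {\<omega>\<in>space M. survives D x h s \<omega>}) \<partial>lborel)"
      by (rule nn_integral_cmult) measurable
    also have "\<dots> \<le> ennreal (C powr (p' - 1)) * ennreal (1 / (1 - \<beta>) + 2 * h / ln 2)"
    proof (intro mult_left_mono nn_integral_powr_survival \<beta> h)
      fix s :: real assume "0 < s"
      show "emeasure M {\<omega>\<in>space M. survives D x h s \<omega>} \<le> 1" by (rule emeasure_le_1)
      show "emeasure M {\<omega>\<in>space M. survives D x h s \<omega>} \<le> ennreal (2 * exp (- (ln 2 / h) * s))"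
        using \<kappa> by (intro emeasure_survives_le \<Psi> D x Db h R \<open>0 < s\<close>) (simp only: h\<Psi>)
    qed simp
    also have "\<dots> = ennreal ?N"
      using \<beta> h unfolding h_def[symmetric] by (intro ennreal_mult[symmetric] add_nonneg_nonneg) auto
    finally show ?thesis .
  qed
  have N0: "0 < ?N"
    using \<beta> h \<open>0 < C\<close> unfolding h_def[symmetric] by (intro mult_pos_pos add_pos_nonneg) auto
  define weight where "weight s \<omega> = exp (- (LINT r:{0..s}|lebesgue. V (t + r, started_at x X r \<omega>)))" for s \<omega>
  \<comment> \<open>Nonnegativity of \<open>V\<close> makes the exponent nonpositive. Should the
    integral of \<open>V\<close> along the path not exist, it is 0 and the weight equals 1.\<close>
  have weight: "0 \<le> weight s \<omega> \<and> weight s \<omega> \<le> 1" for s \<omega>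
  proof -
    have "0 \<le> (LINT r:{0..s}|lebesgue. V (t + r, started_at x X r \<omega>))"
      unfolding set_lebesgue_integral_def using V t
      by (intro integral_nonneg_AE AE_I2) (auto simp: indicator_def)
    then show ?thesis unfolding weight_def by simp
  qed
  let ?\<sigma> = "capped_exit_time D (started_at x X) (T - t)"
  have cont: "continuous_on ({0..T} \<times> UNIV) \<phi>"
    using sub by (simp add: parabolic_weak_subsolution_def)
  have "\<phi> (t, x) \<le> (\<integral>\<omega>. weight (?\<sigma> \<omega>) \<omega> * \<phi> (t + ?\<sigma> \<omega>, started_at x X (?\<sigma> \<omega>) \<omega>) \<partial>completion M) +
    (\<integral>\<omega>. (LINT s:{0..?\<sigma> \<omega>}|lebesgue. weight s \<omega> * f (t + s, started_at x X s \<omega>)) \<partial>completion M)"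
    using sub t x unfolding parabolic_weak_subsolution_def Let_def weight_def by auto
  also have "(\<integral>\<omega>. weight (?\<sigma> \<omega>) \<omega> * \<phi> (t + ?\<sigma> \<omega>, started_at x X (?\<sigma> \<omega>) \<omega>) \<partial>completion M) \<le> ?m"
    by (rule boundary_term_le(2)[where weight=weight and x=x, OF D(2,3,1) \<open>T > 0\<close> t cont bdd weight])
  finally have le: "\<phi> (t, x) \<le> ?m + (\<integral>\<omega>. (LINT s:{0..?\<sigma> \<omega>}|lebesgue. weight s \<omega> * f (t + s, started_at x X s \<omega>)) \<partial>completion M)"
    by simp
  have main: "\<phi> (t, x) \<le> ?m + ?N powr (1 / p') * G" if "?G \<le> G" "0 < G" for G
    using le source_term_le[where weight=weight, OF D(2) t weight p K K0 heat h N0 N f that] by linarith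
  have G0: "0 \<le> ?G" unfolding Lp_norm_def by simp
  have "\<phi> (t, x) \<le> ?m + ?N powr (1 / p') * ?G"
  \<comment> \<open>The source bound requires a positive G, while the norm may vanish. Taking G =
    \<open>?G + e / ?c\<close> costs exactly \<open>e\<close>.\<close>
  proof (rule field_le_epsilon)
    fix e :: real assume "e > 0"
    let ?c = "?N powr (1 / p')"
    have c: "?c > 0" using N0 by (simp only: powr_gt_zero less_imp_neq[symmetric] not_False_eq_True)
    have "\<phi> (t, x) \<le> ?m + ?c * (?G + e / ?c)"
      using G0 c \<open>e > 0\<close> by (intro main) (auto intro: add_nonneg_pos)
    also have "\<dots> = ?m + ?c * ?G + e" using c by (simp add: distrib_left)
    finally show "\<phi> (t, x) \<le> ?m + ?c * ?G + e" .
  qed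
  moreover have "0 \<le> ?m + ?N powr (1 / p') * ?G"
    using boundary_term_le(1)[OF D(2,3,1) \<open>T > 0\<close> t cont bdd weight] G0 by (intro add_nonneg_nonneg) auto
  ultimately show "max (\<phi> z) 0 \<le> ?m + ?N powr (1 / p') * ?G"
    unfolding z by simp
qed

end

text \<open>Passes from the exponent q = 1/p' that the argument delivers to the exponent 2/p' in the
  theorem: for y \<ge> 1 the larger power dominates, and for y < 1 the constant does. The condition
  q \<le> 1 keeps 2^q below 2.\<close>

lemma one_plus_powr_le:
  fixes y q :: real
  assumes "0 \<le> y" "0 < q" "q \<le> 1"
  shows "(1 + y) powr q \<le> 2 * (1 + y powr (2 * q))"
proof -
  have "(1 + y) powr q \<le> (2 * max 1 y) powr q"
    using assms by (intro powr_mono2) auto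
  also have "\<dots> = 2 powr q * max 1 y powr q" by (rule powr_mult)
  also have "\<dots> \<le> 2 * (1 + y powr (2 * q))"
  proof (intro mult_mono)
    show "(2::real) powr q \<le> 2" using powr_mono[of q 1 "2::real"] assms by simp
    show "max 1 y powr q \<le> 1 + y powr (2 * q)"
    proof (cases "1 \<le> y")
      case True
      then have "y powr q \<le> y powr (2 * q)" using assms by (intro powr_mono) auto
      with True show ?thesis by (simp add: max_absorb2)
    qed (simp add: max_absorb1)
  qed auto
  finally show ?thesis .
qed

theorem theorem3p2:
  fixes \<Psi> :: "real \<Rightarrow> real" and \<mu> c \<theta> p p' :: real
  assumes "bernstein0 \<Psi>"
    and "strict_mono_on {0<..} \<Psi>"
    and "\<mu> > 0" and "0 < c" and "c \<le> 1" and "\<theta> \<ge> 0"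
    and "weak_lower_scaling \<Psi> \<mu> c \<theta>"
    and "p - 1 > real DIM('a::euclidean_space) / (2 * \<mu>)"
    and "1 / p + 1 / p' = 1"
  shows "\<exists>C>0. \<forall>(M :: 'w measure) (X :: real \<Rightarrow> 'w \<Rightarrow> 'a) (D :: 'a set) (T :: real)
      (V :: real \<times> 'a \<Rightarrow> real) (f :: real \<times> 'a \<Rightarrow> real) (\<phi> :: real \<times> 'a \<Rightarrow> real).
    subordinate_brownian_motion M \<Psi> X \<longrightarrow>
    D \<noteq> {} \<longrightarrow> open D \<longrightarrow> connected D \<longrightarrow> bounded D \<longrightarrow> regular_boundary M X D \<longrightarrow>
    T > 0 \<longrightarrow>
    V \<in> borel_measurable (lebesgue_on ({0..} \<times> UNIV)) \<longrightarrow>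
    bounded (V ` ({0..} \<times> UNIV)) \<longrightarrow>
    (\<forall>z\<in>{0..} \<times> UNIV. 0 \<le> V z) \<longrightarrow>
    in_Lp p ({0..<T} \<times> D) f \<longrightarrow>
    bounded (\<phi> ` ({0..T} \<times> UNIV)) \<longrightarrow>
    parabolic_weak_subsolution M X D V T f \<phi> \<longrightarrow>
    (SUP z\<in>{0..<T} \<times> D. max (\<phi> z) 0) \<le>
      max (SUP z\<in>{0..<T} \<times> (- D). max (\<phi> z) 0) (SUP z\<in>{T} \<times> D. max (\<phi> z) 0)
      + C * (1 + 1 / \<Psi> (diameter D powr (-2)) powr (2 / p')) * Lp_norm p ({0..<T} \<times> D) f"
proof -
  let ?\<delta> = "real DIM('a) / (2 * \<mu>)"
  have \<delta>: "0 < ?\<delta>" using assms(3) by simp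
  have p1: "p > 1" using assms(8) \<delta> by linarith
  have pos: "0 < \<Psi> u" if "0 < u" for u using assms(1,2) that by (rule bernstein0_pos)
  have "1 / p' = (p - 1) / p" using assms(9) p1 by (simp add: field_simps)
  then have "1 / (1 / p') = 1 / ((p - 1) / p)" by (simp only:)
  then have p'_eq: "p' = p / (p - 1)" by simp
  have p'1: "p' > 1" using p1 assms(9) by (rule conjugate_exponent_gt_1)
  \<comment> \<open>This identity turns the lower bound on p - 1 into integrability near time 0: the
    density bound raised to the power p' - 1 behaves like s^(-\<delta>/(p-1)), with exponent above
    -1.\<close>
  have "p' - 1 = 1 / (p - 1)" unfolding p'_eq using p1 by (simp add: field_simps)
  then have "?\<delta> * (p' - 1) = ?\<delta> / (p - 1)" by (simp only: times_divide_eq_right mult_1_right)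
  also have "\<dots> < 1" using assms(8) p1 by (subst divide_less_eq_1_pos) auto
  finally have \<beta>1: "?\<delta> * (p' - 1) < 1" .
  obtain A where A: "A > 0" "\<forall>s>0. \<exists>\<psi>\<in>borel_measurable borel.
      (\<forall>\<xi>::'a. \<xi> \<noteq> 0 \<longrightarrow> ennreal (exp (- s * \<Psi> ((norm \<xi>)\<^sup>2))) \<le> \<psi> \<xi>) \<and>
      (\<integral>\<^sup>+\<xi>. \<psi> \<xi> \<partial>lborel) \<le> ennreal (A * max 1 (s powr - ?\<delta>))"
    using exp_symbol_integral_bound[OF assms(7,3,4,6) pos, where 'a='a] by blast
  obtain \<kappa> where \<kappa>: "\<kappa> > 0" "exp (1 / 2) * (\<integral>x. std_normal_density x * exp (- \<kappa> * (min (x\<^sup>2) 1 / 2)) \<partial>lborel) \<le> 1 / 2"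
    using exists_small_gaussian_average by blast
  define b where "b = 1 / (1 - ?\<delta> * (p' - 1))"
  have b: "b > 0" unfolding b_def using \<beta>1 by simp
  \<comment> \<open>Collects everything apart from the diameter: \<open>A\<close> from the density
    bound, \<open>b\<close> from the singularity at time 0, and \<kappa> from the survival
    estimate.\<close>
  define E where "E = A powr (p' - 1) * (b + 2 * \<kappa> / ln 2)"
  have E: "E > 0" unfolding E_def using A b \<kappa> by (intro mult_pos_pos add_pos_nonneg) auto
  have const: "(A powr (p' - 1) * (b + 2 * (\<kappa> / w) / ln 2)) powr (1 / p') \<le> 2 * E powr (1 / p') * (1 + 1 / w powr (2 / p'))"
    if "0 < w" for w
  proof -
    \<comment> \<open>Expanding the product on the right gives the left side plus nonnegative cross
      terms. This separates the dependence on \<open>w\<close> before taking the power 1/p'.\<close>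
    have "b + 2 * (\<kappa> / w) / ln 2 \<le> (b + 2 * \<kappa> / ln 2) * (1 + 1 / w)"
    proof -
      have "(b + 2 * \<kappa> / ln 2) * (1 + 1 / w) = b + 2 * (\<kappa> / w) / ln 2 + (b / w + 2 * \<kappa> / ln 2)"
        by (simp add: algebra_simps add_divide_distrib)
      moreover have "0 \<le> b / w + 2 * \<kappa> / ln 2" using b \<kappa> that by simp
      ultimately show ?thesis by linarith
    qed
    then have "A powr (p' - 1) * (b + 2 * (\<kappa> / w) / ln 2) \<le> E * (1 + 1 / w)"
      unfolding E_def mult.assoc by (intro mult_left_mono) auto
    then have "(A powr (p' - 1) * (b + 2 * (\<kappa> / w) / ln 2)) powr (1 / p') \<le> (E * (1 + 1 / w)) powr (1 / p')"
      using b \<kappa> that p'1 by (intro powr_mono2) auto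
    also have "\<dots> = E powr (1 / p') * (1 + 1 / w) powr (1 / p')"
      by (rule powr_mult)
    also have "\<dots> \<le> E powr (1 / p') * (2 * (1 + (1 / w) powr (2 * (1 / p'))))"
      using that p'1 by (intro mult_left_mono one_plus_powr_le) auto
    also have "\<dots> = 2 * E powr (1 / p') * (1 + 1 / w powr (2 / p'))"
      using that by (simp add: powr_divide)
    finally show ?thesis .
  qed
  show ?thesis
  \<comment> \<open>The witness is fixed before the process, domain, horizon and functions are
    introduced. The factor 2 comes from \<open>one_plus_powr_le\<close>, and \<open>E\<close> is
    built from quantities attached to p, the dimension and \<Psi> with its scaling
    parameters.\<close>
  proof (intro exI[of _ "2 * E powr (1 / p')"] conjI allI impI)
    show "0 < 2 * E powr (1 / p')" using E by simp
    fix M :: "'w measure" and X :: "real \<Rightarrow> 'w \<Rightarrow> 'a" and D T and V f \<phi> :: "real \<times> 'a \<Rightarrow> real"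
    assume X: "subordinate_brownian_motion M \<Psi> X"
      and D: "D \<noteq> {}" "open D" "bounded D" and T: "T > 0" and V: "\<forall>z\<in>{0..} \<times> UNIV. 0 \<le> V z"
      and f: "in_Lp p ({0..<T} \<times> D) f" and \<phi>: "bounded (\<phi> ` ({0..T} \<times> UNIV))"
        "parabolic_weak_subsolution M X D V T f \<phi>"
    obtain B S where BS: "brownian_motion M B" "subordinator M \<Psi> S"
      "prob_space.indep_set M (process_sets M B) (process_sets M S)" "X = (\<lambda>t \<omega>. B (S t \<omega>) \<omega>)"
      using X unfolding subordinate_brownian_motion_def by blast
    interpret sbm: subordination M B S \<Psi>
      by unfold_locales (fact BS)+
    have X_eq: "X = sbm.X" unfolding BS(4) sbm.X_def[abs_def] ..
    let ?w = "\<Psi> (diameter D powr - 2)"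
    have w: "0 < ?w" using diameter_pos[OF D(2,3,1)] by (intro pos) simp
    have "(SUP z\<in>{0..<T} \<times> D. max (\<phi> z) 0) \<le>
      max (SUP z\<in>{0..<T} \<times> (- D). max (\<phi> z) 0) (SUP z\<in>{T} \<times> D. max (\<phi> z) 0)
      + (A powr (p' - 1) * (b + 2 * (\<kappa> / ?w) / ln 2)) powr (1 / p') * Lp_norm p ({0..<T} \<times> D) f"
      unfolding b_def
      by (rule sbm.subsolution_le[OF assms(1,2) p1 assms(9) \<delta> \<beta>1 A(1) \<kappa>(1) A(2)[rule_format] \<kappa>(2) D T V f \<phi>(1) \<phi>(2)[unfolded X_eq]])
    also have "\<dots> \<le> max (SUP z\<in>{0..<T} \<times> (- D). max (\<phi> z) 0) (SUP z\<in>{T} \<times> D. max (\<phi> z) 0)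
      + 2 * E powr (1 / p') * (1 + 1 / ?w powr (2 / p')) * Lp_norm p ({0..<T} \<times> D) f"
      by (intro add_left_mono mult_right_mono const w) (simp add: Lp_norm_def)
    finally show "(SUP z\<in>{0..<T} \<times> D. max (\<phi> z) 0) \<le>
      max (SUP z\<in>{0..<T} \<times> (- D). max (\<phi> z) 0) (SUP z\<in>{T} \<times> D. max (\<phi> z) 0)
      + 2 * E powr (1 / p') * (1 + 1 / \<Psi> (diameter D powr (-2)) powr (2 / p')) * Lp_norm p ({0..<T} \<times> D) f" .
  qed
qed

end
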